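(* Let $L$ be the response matrix of a superport network. For any non-root boundary vertices $i$ and $j$ (possibly equal), the entry of $L$ in row $i$ and column $j$ equals $$L_i^j=\frac{\sum_G \mathrm{sgn}(G,i,j)\cdot w(G)}{\sum_F w(F)},$$ where the sum in the denominator is over all valid forests $F$, and the sum in the numerator is over all spanning forests $G$ which are valid relative to each of the vertices $i$ and $j$ separately.
   Context: A superport network with $p\ge 1$ superports is a finite connected graph (without loops or multiple edges) together with non-empty pairwise disjoint sets $A_1,\dots,A_p$ of vertices (superports) and a positive number (conductance) assigned to each edge. Vertices in $M:=A_1\cup\dots\cup A_p$ are called boundary, the others interior; $m:=|M|$. The vertices are numbered $1,\dots,n$ so that $A_1=\{1,\dots,|A_1|\}$, $A_2=\{|A_1|+1,\dots,|A_1|+|A_2|\}$, and so on; thus $M=\{1,\dots,m\}$. Let $c_{kl}=c_{lk}$ be the conductance of the edge $kl$, with $c_{kl}=0$ if there is no such edge (in particular $c_{kk}=0$). The root of a superport is its vertex with the maximal number; $R$ is the set of roots, and $\mathrm{root}(k)$ is the root of the superport containing the boundary vertex $k$. Given real numbers $\Delta U_{k,\mathrm{root}(k)}$ (prescribed voltage differences) for all non-root boundary vertices $k$, the voltages $U_k$ $(1\le k\le n)$ and the currents $I_{kl}$ $(1\le k,l\le n)$ are determined (the $I_{kl}$ uniquely, the $U_k$ uniquely up to a common additive constant) by the following conditions, where $I_k:=\sum_{l=1}^n I_{kl}$: (C) $I_{kl}=c_{kl}(U_k-U_l)$ for all ordered pairs $k,l$; (I) $\sum_{l=1}^n I_{kl}=0$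 for each $k>m$; (P) $\sum_{k\in A_i}I_k=0$ for each $i=1,\dots,p-1$; (B) $U_k-U_{\mathrm{root}(k)}=\Delta U_{k,\mathrm{root}(k)}$ for each non-root boundary vertex $k$. Let $m>p$ and let $x_1<\dots<x_{m-p}$ be the non-root boundary vertices. The response matrix $L$ is the matrix of the linear map $\mathbb{R}^{m-p}\to\mathbb{R}^{m-p}$, $(\Delta U_{x_1,\mathrm{root}(x_1)},\dots,\Delta U_{x_{m-p},\mathrm{root}(x_{m-p})})\mapsto(I_{x_1},\dots,I_{x_{m-p}})$; its rows and columns are indexed by $M\setminus R=\{x_1,\dots,x_{m-p}\}$. A spanning forest is an acyclic subgraph containing all the vertices (isolated vertices allowed). The weight $w(H)$ of a forest $H$ is the product of the conductances of all its edges (an empty product is $1$). Quotients of a graph or forest by an equivalence relation on vertices are multigraphs: edges are kept as distinct edges, possibly becoming parallel edges or loops, and a loop or a pair of parallel edges counts as a cycle. Let $\sim$ be the equivalence relation on the vertices for which two boundary vertices are equivalent if and only if they are in the same superport, and the class of each interior vertex is a single vertex. A spanning forest is valid if it becomes a spanning tree in the quotient by $\sim$. For a set $X$ of vertices, the $X$-equivalence is the relation for which two boundary vertices not belonging to $X$ are equivalent if and only if they are in the same superport, and the class of each interior vertex and of each vertex of $X$ is a single vertex. A spanning forest is valid relative to a vertex $i$ if it becomes a spanning tree in the quotient by the $\{i\}$-equivalence. For a spanning forest $G$ put $\mathrm{sgn}(G,i,j)=+1$ if either $i=j$, or $i$ and $j$ are in different components of the quotient of $G$ by the $\{i,j\}$-equivalence;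 otherwise $\mathrm{sgn}(G,i,j)=-1$. *)

theory Defs
  imports Complex_Main "HOL-Library.Disjoint_Sets"
begin

text \<open>
  An undirected multigraph. The set of endpoints of an edge has two elements, or one element
  if the edge is a loop; distinct edges may have the same endpoints.
\<close>

record ('v, 'e) multigraph =
  verts :: "'v set"
  edges :: "'e set"
  ends :: "'e \<Rightarrow> 'v set"

definition adjacent :: "('v, 'e) multigraph \<Rightarrow> 'v \<Rightarrow> 'v \<Rightarrow> bool" where
  "adjacent G u v \<longleftrightarrow> (\<exists>e\<in>edges G. ends G e = {u, v})"

definition same_component :: "('v, 'e) multigraph \<Rightarrow> 'v \<Rightarrow> 'v \<Rightarrow> bool" where
  "same_component G u v \<longleftrightarrow> u \<in> verts G \<and> v \<in> verts G \<and> (adjacent G)\<^sup>*\<^sup>* u v"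

definition connected_mg :: "('v, 'e) multigraph \<Rightarrow> bool" where
  "connected_mg G \<longleftrightarrow> verts G \<noteq> {} \<and> (\<forall>u\<in>verts G. \<forall>v\<in>verts G. same_component G u v)"

text \<open>
  A cycle passes through distinct vertices \<open>vs ! 0, vs ! 1, \<dots>\<close> along distinct edges
  \<open>es ! 0, es ! 1, \<dots>\<close>. Length 1 is a loop, length 2 is a pair of parallel edges.
\<close>

definition is_cycle :: "('v, 'e) multigraph \<Rightarrow> 'v list \<Rightarrow> 'e list \<Rightarrow> bool" where
  "is_cycle G vs es \<longleftrightarrow>
     es \<noteq> [] \<and> length vs = length es \<and> distinct vs \<and> distinct es \<and>
     set vs \<subseteq> verts G \<and> set es \<subseteq> edges G \<and>
     (\<forall>i<length es. ends G (es ! i) = {vs ! i, vs ! (Suc i mod length es)})"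

definition acyclic_mg :: "('v, 'e) multigraph \<Rightarrow> bool" where
  "acyclic_mg G \<longleftrightarrow> (\<nexists>vs es. is_cycle G vs es)"

definition tree_mg :: "('v, 'e) multigraph \<Rightarrow> bool" where
  "tree_mg G \<longleftrightarrow> connected_mg G \<and> acyclic_mg G"

text \<open>
  The edges of the quotient are those of \<open>G\<close>. The endpoints of an edge are replaced by their
  classes: \<open>ends G e // r\<close> is the image of \<open>ends G e\<close> under \<open>v \<mapsto> r `` {v}\<close>.
\<close>

definition quotient_mg :: "('v, 'e) multigraph \<Rightarrow> ('v \<times> 'v) set \<Rightarrow> ('v set, 'e) multigraph" where
  "quotient_mg G r = \<lparr>verts = verts G // r, edges = edges G, ends = (\<lambda>e. ends G e // r)\<rparr>"

text \<open>
  The vertices are \<open>1, \<dots>, nverts N\<close>, the superports are \<open>port N 1, \<dots>, port N (nports N)\<close>,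
  and an edge is the set of its two endpoints.
\<close>

record network =
  nverts :: nat
  nports :: nat
  port :: "nat \<Rightarrow> nat set"
  links :: "nat set set"
  conductance :: "nat set \<Rightarrow> real"

definition vertices :: "network \<Rightarrow> nat set" where
  "vertices N = {1..nverts N}"

definition span_graph :: "network \<Rightarrow> nat set set \<Rightarrow> (nat, nat set) multigraph" where
  "span_graph N F = \<lparr>verts = vertices N, edges = F, ends = (\<lambda>e. e)\<rparr>"

definition superport_network :: "network \<Rightarrow> bool" where
  "superport_network N \<longleftrightarrow>
     links N \<subseteq> {{k, l} |k l. k \<in> vertices N \<and> l \<in> vertices N \<and> k \<noteq> l} \<and>
     connected_mg (span_graph N (links N)) \<and>
     (\<forall>e\<in>links N. 0 < conductance N e) \<and>
     1 \<le> nports N \<and>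
     (\<forall>q\<in>{1..nports N}. port N q \<noteq> {} \<and> port N q \<subseteq> vertices N) \<and>
     disjoint_family_on (port N) {1..nports N} \<and>
     (\<forall>q\<in>{1..nports N}.
        port N q = {(\<Sum>r\<in>{1..<q}. card (port N r)) + 1 .. (\<Sum>r\<in>{1..q}. card (port N r))})"

definition boundary :: "network \<Rightarrow> nat set" where
  "boundary N = (\<Union>q\<in>{1..nports N}. port N q)"

definition roots :: "network \<Rightarrow> nat set" where
  "roots N = (\<lambda>q. Max (port N q)) ` {1..nports N}"

definition port_root :: "network \<Rightarrow> nat \<Rightarrow> nat" where
  "port_root N k = Max (THE S. S \<in> port N ` {1..nports N} \<and> k \<in> S)"

definition cond :: "network \<Rightarrow> nat \<Rightarrow> nat \<Rightarrow> real" where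
  "cond N k l = (if {k, l} \<in> links N then conductance N {k, l} else 0)"

definition net_current :: "network \<Rightarrow> (nat \<Rightarrow> nat \<Rightarrow> real) \<Rightarrow> nat \<Rightarrow> real" where
  "net_current N I k = (\<Sum>l\<in>vertices N. I k l)"

text \<open>
  Only the values of \<open>\<Delta>U\<close> at the non-root boundary vertices matter: \<open>\<Delta>U k\<close> is the prescribed
  difference between the voltages of \<open>k\<close> and \<open>port_root N k\<close>.
\<close>

definition solution ::
  "network \<Rightarrow> (nat \<Rightarrow> real) \<Rightarrow> (nat \<Rightarrow> real) \<Rightarrow> (nat \<Rightarrow> nat \<Rightarrow> real) \<Rightarrow> bool" where
  "solution N \<Delta>U U I \<longleftrightarrow>
     (\<forall>k\<in>vertices N. \<forall>l\<in>vertices N. I k l = cond N k l * (U k - U l)) \<and>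
     (\<forall>k\<in>vertices N - boundary N. net_current N I k = 0) \<and>
     (\<forall>q\<in>{1..<nports N}. (\<Sum>k\<in>port N q. net_current N I k) = 0) \<and>
     (\<forall>k\<in>boundary N - roots N. U k - U (port_root N k) = \<Delta>U k)"

text \<open>
  The vectors of the domain and of the codomain are indexed by \<open>boundary N - roots N\<close>. The current
  at \<open>x\<close> is the common value in all solutions, since \<open>U\<close> is unique only up to a constant (and the
  functions \<open>U\<close>, \<open>I\<close> are arbitrary outside of the vertex set).
\<close>

definition response_map :: "network \<Rightarrow> (nat \<Rightarrow> real) \<Rightarrow> nat \<Rightarrow> real" where
  "response_map N \<Delta>U x = (THE y. \<exists>U I. solution N \<Delta>U U I \<and> y = net_current N I x)"

text \<open>Row \<open>i\<close>, column \<open>j\<close>: the \<open>i\<close>-th coordinate of the image of the \<open>j\<close>-th unit vector.\<close>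

definition response_matrix :: "network \<Rightarrow> nat \<Rightarrow> nat \<Rightarrow> real" where
  "response_matrix N i j = response_map N (\<lambda>k. if k = j then 1 else 0) i"

definition same_port :: "network \<Rightarrow> nat \<Rightarrow> nat \<Rightarrow> bool" where
  "same_port N u v \<longleftrightarrow> (\<exists>q\<in>{1..nports N}. u \<in> port N q \<and> v \<in> port N q)"

definition port_equiv :: "network \<Rightarrow> (nat \<times> nat) set" where
  "port_equiv N = {(u, v). u \<in> vertices N \<and> v \<in> vertices N \<and> (u = v \<or> same_port N u v)}"

definition port_equiv_off :: "network \<Rightarrow> nat set \<Rightarrow> (nat \<times> nat) set" where
  "port_equiv_off N X = {(u, v). u \<in> vertices N \<and> v \<in> vertices N \<and>
     (u = v \<or> u \<notin> X \<and> v \<notin> X \<and> same_port N u v)}"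

text \<open>A spanning subgraph contains all the vertices, hence is given by its set of edges.\<close>

definition spanning_forest :: "network \<Rightarrow> nat set set \<Rightarrow> bool" where
  "spanning_forest N F \<longleftrightarrow> F \<subseteq> links N \<and> acyclic_mg (span_graph N F)"

definition weight :: "network \<Rightarrow> nat set set \<Rightarrow> real" where
  "weight N F = (\<Prod>e\<in>F. conductance N e)"

definition valid :: "network \<Rightarrow> nat set set \<Rightarrow> bool" where
  "valid N F \<longleftrightarrow> spanning_forest N F \<and> tree_mg (quotient_mg (span_graph N F) (port_equiv N))"

definition valid_rel :: "network \<Rightarrow> nat \<Rightarrow> nat set set \<Rightarrow> bool" where
  "valid_rel N i F \<longleftrightarrow>
     spanning_forest N F \<and> tree_mg (quotient_mg (span_graph N F) (port_equiv_off N {i}))"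

definition forest_sgn :: "network \<Rightarrow> nat set set \<Rightarrow> nat \<Rightarrow> nat \<Rightarrow> real" where
  "forest_sgn N G i j =
     (let r = port_equiv_off N {i, j} in
      if i = j \<or> \<not> same_component (quotient_mg (span_graph N G) r) (r `` {i}) (r `` {j})
      then 1 else - 1)"

end

theory Submission
  imports Defs
begin

text \<open>
  Up to an additive constant, a valid forest \<open>F\<close> admits a unique potential \<open>U\<^sub>F\<close> that satisfies the
  boundary conditions for the unit voltage difference at \<open>j\<close> and drives no current through \<open>F\<close>. The
  voltages of the network are the averages of the \<open>U\<^sub>F\<close> with weights \<open>w(F)\<close>. Indeed, for a potential
  \<open>h\<close> the sum over all edges \<open>e\<close> of \<open>c\<^sub>e (dh)\<^sub>e (dU)\<^sub>e\<close> becomes, after grouping the pairs \<open>(F, e)\<close> by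
  \<open>G = F \<union> {e}\<close>, a sum of \<open>w(G) \<langle>z, dh\<rangle> \<langle>z, d\<delta>\<^sub>j\<rangle>\<close>, where \<open>z\<close> is the unit flow around the only cycle of
  \<open>G\<close> modulo the superports and \<open>\<delta>\<^sub>j\<close> is the indicator of \<open>j\<close>. If \<open>h\<close> is constant on the superports,
  this vanishes, which is current conservation. If \<open>h = \<delta>\<^sub>i\<close>, this is the current at \<open>i\<close>, and
  \<open>\<langle>z, d\<delta>\<^sub>i\<rangle>\<close> is \<open>\<plusminus>1\<close> or \<open>0\<close> according to whether \<open>G\<close> is valid relative to \<open>i\<close>. The relative sign
  for \<open>i\<close> and \<open>j\<close> is found by pairing \<open>z\<close> with the indicator of a component of \<open>G\<close> modulo the
  \<open>{i, j}\<close>-equivalence.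
\<close>

section \<open>Acyclic multigraphs and potentials\<close>

text \<open>A walk of least length repeats no vertex: the stretch between two visits could be cut
  out.\<close>

lemma rtranclp_imp_simple_path:
  assumes "R\<^sup>*\<^sup>* u v"
  obtains p n where "p 0 = u" "p n = v" "\<And>k. k < n \<Longrightarrow> R (p k) (p (Suc k))" "inj_on p {..n}"
proof -
  define P where "P n \<longleftrightarrow> (\<exists>p. p 0 = u \<and> p n = v \<and> (\<forall>k<n. R (p k) (p (Suc k))))" for n
  obtain n0 where "(R ^^ n0) u v" using assms by (auto simp: rtranclp_power)
  then have "P n0" unfolding P_def relpowp_fun_conv by blast
  then have "\<exists>n. P n" by blast
  define n where "n = (LEAST n. P n)"
  then have PL: "P n" using \<open>\<exists>n. P n\<close> by (auto intro: LeastI_ex)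
  obtain p where p: "p 0 = u" "p n = v" "\<forall>k<n. R (p k) (p (Suc k))"
    using PL unfolding P_def by blast
  have "False" if ab: "a < b" "b \<le> n" "p a = p b" for a b
  proof -
    \<comment> \<open>\<open>q\<close> follows \<open>p\<close> up to index \<open>a\<close> and
      then skips the stretch between \<open>a\<close> and \<open>b\<close>.\<close>
    define q where "q k = (if k \<le> a then p k else p (k + (b - a)))" for k
    have "P (n - (b - a))" unfolding P_def
    proof (intro exI[of _ q] conjI allI impI)
      show "q 0 = u" using p by (simp add: q_def)
      show "q (n - (b - a)) = v"
      proof (cases "b = n")
        case True
        then have "n - (b - a) = a" using ab by simp
        then show ?thesis using ab p(2) True by (simp add: q_def)
      next
        case False
        then have "\<not> n - (b - a) \<le> a" "n - (b - a) + (b - a) = n" using ab by simp_all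
        then show ?thesis using p(2) unfolding q_def by simp
      qed
      fix k assume k: "k < n - (b - a)"
      show "R (q k) (q (Suc k))"
      proof (cases "k = a")
        case True
        then have "q k = p b" "q (Suc k) = p (Suc b)" "b < n" using ab k by (simp_all add: q_def)
        then show ?thesis using p(3) by simp
      next
        case False
        show ?thesis
        proof (cases "k < a")
          case True
          then show ?thesis using p(3) ab by (simp add: q_def)
        next
          case False
          then have "q k = p (k + (b - a))" "q (Suc k) = p (Suc (k + (b - a)))" "k + (b - a) < n"
            using \<open>k \<noteq> a\<close> k by (simp_all add: q_def)
          then show ?thesis using p(3) by simp
        qed
      qed
    qed
    then have "n \<le> n - (b - a)" unfolding n_def by (rule Least_le)
    then show False using ab by linarith
  qed
  note no_repeat = this
  have "inj_on p {..n}"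
  proof (rule linorder_inj_onI')
    fix a b assume "a \<in> {..n}" "b \<in> {..n}" "a < b"
    then show "p a \<noteq> p b" using no_repeat[of a b] by auto
  qed
  then show thesis using p by (intro that[of p n]) auto
qed

text \<open>A path between the ends that avoids \<open>e\<close> can be taken simple, and
  \<open>e\<close> closes it to a cycle. For \<open>u = v\<close> the path is trivial and
  \<open>e\<close> is a loop.\<close>

lemma acyclic_mg_bridge:
  assumes acyc: "acyclic_mg G" and e: "e \<in> edges G" "ends G e = {u, v}"
    and sub: "\<And>e. e \<in> edges G \<Longrightarrow> ends G e \<subseteq> verts G"
  shows "\<not> (adjacent (G\<lparr>edges := edges G - {e}\<rparr>))\<^sup>*\<^sup>* u v"
proof
  assume "(adjacent (G\<lparr>edges := edges G - {e}\<rparr>))\<^sup>*\<^sup>* u v"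
  from rtranclp_imp_simple_path[OF this]
  obtain p n where p: "p 0 = u" "p n = v" "inj_on p {..n}"
    and adj: "\<And>k. k < n \<Longrightarrow> adjacent (G\<lparr>edges := edges G - {e}\<rparr>) (p k) (p (Suc k))"
    by metis
  have "\<forall>k\<in>{..<n}. \<exists>x. x \<in> edges G - {e} \<and> ends G x = {p k, p (Suc k)}"
    using adj by (auto simp: adjacent_def)
  then obtain x where x: "\<And>k. k < n \<Longrightarrow> x k \<in> edges G - {e} \<and> ends G (x k) = {p k, p (Suc k)}"
    by (metis lessThan_iff)
  have injx: "inj_on x {..<n}"
  proof (rule inj_onI)
    fix a b assume ab: "a \<in> {..<n}" "b \<in> {..<n}" "x a = x b"
    then have "{p a, p (Suc a)} = {p b, p (Suc b)}" using x by (metis lessThan_iff)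
    then have "(p a = p b) \<or> (p a = p (Suc b) \<and> p (Suc a) = p b)" by (auto simp: doubleton_eq_iff)
    then show "a = b" using ab p(3) by (auto simp: inj_on_eq_iff)
  qed
  have pv: "p k \<in> verts G" if "k \<le> n" for k
  proof (cases "k < n")
    case True
    then show ?thesis using x sub by blast
  next
    case False
    then show ?thesis using that p e sub by auto
  qed
  have "is_cycle G (map p [0..<Suc n]) (map x [0..<n] @ [e])"
    unfolding is_cycle_def
  proof (intro conjI allI impI)
    show "distinct (map p [0..<Suc n])"
      using p(3) by (auto simp: distinct_map atLeast0LessThan lessThan_Suc_atMost simp del: upt_Suc)
    show "distinct (map x [0..<n] @ [e])"
      using injx x by (auto simp: distinct_map atLeast0LessThan)
    show "set (map p [0..<Suc n]) \<subseteq> verts G" using pv by (auto simp: less_Suc_eq_le)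
    show "set (map x [0..<n] @ [e]) \<subseteq> edges G" using x e by auto
    fix k assume "k < length (map x [0..<n] @ [e])"
    then have "k \<le> n" by simp
    then show "ends G ((map x [0..<n] @ [e]) ! k) =
      {map p [0..<Suc n] ! k, map p [0..<Suc n] ! (Suc k mod length (map x [0..<n] @ [e]))}"
      using x[of k] e p by (cases "k = n") (auto simp: nth_append simp del: upt_Suc)
  qed auto
  then show False using acyc by (auto simp: acyclic_mg_def)
qed

text \<open>Along a cycle, a function that is constant across every edge but the first has the same
  value at both ends of the first edge too.\<close>

lemma acyclic_mgI_potential:
  assumes sep: "\<And>e u v. e \<in> edges G \<Longrightarrow> ends G e = {u, v} \<Longrightarrow>
    \<exists>f :: 'v \<Rightarrow> real. f u \<noteq> f v \<and> (\<forall>e'\<in>edges G - {e}. \<forall>x\<in>ends G e'. \<forall>y\<in>ends G e'. f x = f y)"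
  shows "acyclic_mg (G :: ('v, 'e) multigraph)"
  unfolding acyclic_mg_def
proof clarify
  fix vs es assume cyc: "is_cycle G vs es"
  define n where "n = length es"
  have n: "0 < n" "distinct es"
    and es: "\<And>k. k < n \<Longrightarrow> es ! k \<in> edges G"
    and en: "\<And>k. k < n \<Longrightarrow> ends G (es ! k) = {vs ! k, vs ! (Suc k mod n)}"
    using cyc by (auto simp: is_cycle_def n_def)
  obtain f :: "'v \<Rightarrow> real" where f: "f (vs ! 0) \<noteq> f (vs ! (1 mod n))"
    and fe: "\<And>e x y. e \<in> edges G - {es ! 0} \<Longrightarrow> x \<in> ends G e \<Longrightarrow> y \<in> ends G e \<Longrightarrow> f x = f y"
    using sep[OF es[OF n(1)] en[OF n(1)]] by auto
  have step: "f (vs ! k) = f (vs ! (Suc k mod n))" if "0 < k" "k < n" for k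
    using that n es[of k] en[of k]
    by (intro fe[of "es ! k"]) (auto simp: n_def nth_eq_iff_index_eq)
  have "0 < k \<Longrightarrow> k \<le> n \<Longrightarrow> f (vs ! (k mod n)) = f (vs ! (1 mod n))" for k
  proof (induction k)
    case (Suc k)
    then show ?case using step[of k] by (cases "k = 0") auto
  qed simp
  \<comment> \<open>At \<open>k = n\<close> the index wraps around to \<open>0\<close>; for a loop
    \<open>1 mod n\<close> is \<open>0\<close>, so the choice of \<open>f\<close> is already
    contradictory.\<close>
  from this[of n] f n show False by simp
qed

section \<open>Potentials on a network modulo an equivalence\<close>

text \<open>This is the coboundary of \<open>g\<close>, with each edge oriented from its smaller to
  its larger end.\<close>

definition volt :: "(nat \<Rightarrow> real) \<Rightarrow> nat set \<Rightarrow> real" where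
  "volt g e = g (Max e) - g (Min e)"

text \<open>
  The first condition says that the coboundaries of the potentials that are constant on the
  classes of \<open>r\<close> separate the edges of \<open>X\<close> (no cycles), the second one that the quotient by \<open>r\<close>
  is connected.
\<close>

definition potential_tree :: "nat set \<Rightarrow> (nat \<times> nat) set \<Rightarrow> nat set set \<Rightarrow> bool" where
  "potential_tree V r X \<longleftrightarrow>
     (\<forall>e\<in>X. \<exists>f. f respects r \<and> (\<forall>e'\<in>X. volt f e' = (if e' = e then 1 else 0))) \<and>
     (\<forall>g. g respects r \<longrightarrow> (\<forall>e\<in>X. volt g e = 0) \<longrightarrow> (\<forall>u\<in>V. \<forall>v\<in>V. g u = g v))"

lemma volt_diff: "volt (\<lambda>x. f x - g x) e = volt f e - volt g e"
  and volt_scale: "volt (\<lambda>x. a * f x) e = a * volt f e"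
  and volt_uminus: "volt (\<lambda>x. - f x) e = - volt f e"
  and volt_div: "volt (\<lambda>x. f x / a) e = volt f e / a"
  and volt_sum: "volt (\<lambda>x. \<Sum>k\<in>A. h k x) e = (\<Sum>k\<in>A. volt (h k) e)"
  by (simp_all add: volt_def algebra_simps sum_subtractf diff_divide_distrib)

lemma volt_eq_0_iff: "e = {k, l} \<Longrightarrow> volt g e = 0 \<longleftrightarrow> g k = g l"
  by (cases k l rule: linorder_cases) (auto simp: volt_def max_def min_def)

lemma volt_Ints: "(\<And>v. g v \<in> \<int>) \<Longrightarrow> volt g e \<in> \<int>"
  by (simp add: volt_def)

text \<open>The source of the unit coefficients below: an integer with an integer inverse is 1 or
  -1.\<close>

lemma Ints_mult_eq_1_imp_square:
  fixes a b :: real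
  assumes "a \<in> \<int>" "b \<in> \<int>" "a * b = 1"
  shows "a * a = 1"
proof -
  obtain m n where "a = of_int m" "b = of_int n" using assms by (auto elim!: Ints_cases)
  then have "m * n = 1" using assms(3) by (metis of_int_eq_1_iff of_int_mult)
  then have "m = 1 \<or> m = -1" by (simp add: zmult_eq_1_iff) auto
  then show ?thesis using \<open>a = of_int m\<close> by auto
qed

locale superport_net =
  fixes N :: network
  assumes net: "superport_network N"
begin

abbreviation "V \<equiv> vertices N"
abbreviation "E \<equiv> links N"
abbreviation "qtree r X \<equiv> potential_tree V r X"

lemma net_links: "E \<subseteq> {{k, l} |k l. k \<in> V \<and> l \<in> V \<and> k \<noteq> l}"
  and net_connected: "connected_mg (span_graph N E)"
  and net_pos: "\<forall>e\<in>E. 0 < conductance N e"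
  and net_port: "\<forall>q\<in>{1..nports N}. port N q \<noteq> {} \<and> port N q \<subseteq> V"
  and net_disjoint: "disjoint_family_on (port N) {1..nports N}"
  using net unfolding superport_network_def by - (elim conjE, assumption)+

lemma finite_V: "finite V"
  by (simp add: vertices_def)

lemma E_cases:
  assumes "e \<in> E"
  obtains k l where "e = {k, l}" "k \<in> V" "l \<in> V" "k < l"
proof -
  obtain k l where "e = {k, l}" "k \<in> V" "l \<in> V" "k \<noteq> l"
    using assms net_links by blast
  then show thesis using that[of k l] that[of l k] by (metis insert_commute linorder_neqE)
qed

lemma finite_E: "finite E"
proof (rule finite_subset)
  show "E \<subseteq> Pow V"
  proof
    fix e assume "e \<in> E"
    then obtain k l where "e = {k, l}" "k \<in> V" "l \<in> V" by (rule E_cases)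
    then show "e \<in> Pow V" by simp
  qed
qed (simp add: finite_V)

lemma finite_sub_E: "X \<subseteq> E \<Longrightarrow> finite X"
  using finite_E finite_subset by blast

lemma V_nonempty: "V \<noteq> {}"
  using net_connected by (auto simp: connected_mg_def span_graph_def)

section \<open>Connectivity and cycles of quotients, expressed through potentials\<close>

abbreviation "qgraph r X \<equiv> quotient_mg (span_graph N X) r"

lemma qgraph_simps:
  "verts (qgraph r X) = V // r" "edges (qgraph r X) = X" "ends (qgraph r X) e = e // r"
  by (simp_all add: quotient_mg_def span_graph_def)

lemma qgraph_ends: "ends (qgraph r X) {k, l} = {r `` {k}, r `` {l}}"
  by (auto simp: qgraph_simps quotient_def)

lemma qgraph_remove: "(qgraph r X)\<lparr>edges := X - {e}\<rparr> = qgraph r (X - {e})"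
  by (simp add: quotient_mg_def span_graph_def)

definition joined :: "(nat \<times> nat) set \<Rightarrow> nat set set \<Rightarrow> nat \<Rightarrow> nat \<Rightarrow> bool" where
  "joined r X u v \<longleftrightarrow> (adjacent (qgraph r X))\<^sup>*\<^sup>* (r `` {u}) (r `` {v})"

text \<open>Induction along the path of classes: \<open>g\<close> is constant on each class and does
  not change across an edge of zero voltage.\<close>

lemma joined_eq:
  assumes "equiv V r" "X \<subseteq> E" "joined r X u v" "u \<in> V" "v \<in> V"
    and g: "g respects r" "\<And>e. e \<in> X \<Longrightarrow> volt g e = 0"
  shows "g u = g v"
proof -
  have "\<forall>x\<in>r `` {v}. g x = g u" using assms(3) unfolding joined_def
  proof (induction rule: rtranclp_induct)
    case base
    then show ?case using congruentD[OF g(1)] by auto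
  next
    case (step C D)
    then obtain e where e: "e \<in> X" "ends (qgraph r X) e = {C, D}"
      by (auto simp: adjacent_def qgraph_simps)
    then obtain k l where kl: "e = {k, l}" "k \<in> V" "l \<in> V" using assms(2) by (meson E_cases subsetD)
    then have "{r `` {k}, r `` {l}} = {C, D}" using e qgraph_ends by metis
    moreover have "g k = g l" using g(2)[OF e(1)] volt_eq_0_iff[OF kl(1)] by simp
    moreover have "k \<in> r `` {k}" "l \<in> r `` {l}"
      using kl equiv_class_self[OF assms(1)] by simp_all
    ultimately have "\<exists>x\<in>D. g x = g u"
      using step.IH by (metis doubleton_eq_iff)
    moreover have "g x = g y" if "x \<in> D" "y \<in> D" for x y
    proof -
      have "D = r `` {k} \<or> D = r `` {l}"
        using \<open>{r `` {k}, r `` {l}} = {C, D}\<close> by (metis doubleton_eq_iff)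
      then show ?thesis using that congruentD[OF g(1)] by (metis Image_singleton_iff)
    qed
    ultimately show ?case by metis
  qed
  moreover have "v \<in> r `` {v}" using assms(5) by (rule equiv_class_self[OF assms(1)])
  ultimately show ?thesis by simp
qed

text \<open>Indicators of components serve as test potentials that detect whether vertices are
  joined.\<close>

lemma joined_indicator:
  assumes "equiv V r" "X \<subseteq> E"
  shows "(\<lambda>v. of_bool (joined r X u v) :: real) respects r"
    and "e \<in> X \<Longrightarrow> volt (\<lambda>v. of_bool (joined r X u v)) e = 0"
proof -
  show "(\<lambda>v. of_bool (joined r X u v) :: real) respects r"
  proof (rule congruentI)
    fix y z assume "(y, z) \<in> r"
    then have "r `` {y} = r `` {z}" using assms(1) by (rule equiv_class_eq[rotated])
    then show "of_bool (joined r X u y) = (of_bool (joined r X u z) :: real)"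
      by (simp add: joined_def)
  qed
  assume e: "e \<in> X"
  then obtain k l where kl: "e = {k, l}" using assms(2) by (metis E_cases subsetD)
  then have "adjacent (qgraph r X) (r `` {k}) (r `` {l})" "adjacent (qgraph r X) (r `` {l}) (r `` {k})"
    using e qgraph_ends[of X r k l] by (auto simp: adjacent_def qgraph_simps insert_commute)
  then have "joined r X u k = joined r X u l"
    unfolding joined_def by (meson rtranclp.rtrancl_into_rtrancl)
  then show "volt (\<lambda>v. of_bool (joined r X u v)) e = 0"
    using volt_eq_0_iff[OF kl] by simp
qed

lemma acyclic_quotientI:
  assumes r: "equiv V r" and X: "X \<subseteq> E"
    and dual: "\<And>e. e \<in> X \<Longrightarrow>
      \<exists>f. f respects r \<and> (\<forall>e'\<in>X. volt f e' = (if e' = e then 1 else 0))"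
  shows "acyclic_mg (qgraph r X)"
proof (rule acyclic_mgI_potential)
  fix e A B assume e: "e \<in> edges (qgraph r X)" "ends (qgraph r X) e = {A, B}"
  then have eX: "e \<in> X" by (simp add: qgraph_simps)
  then obtain f where f: "f respects r" "\<And>e'. e' \<in> X \<Longrightarrow> volt f e' = (if e' = e then 1 else 0)"
    using dual by blast
  \<comment> \<open>\<open>F\<close> is \<open>f\<close> pushed down to the classes; as
    \<open>f\<close> respects \<open>r\<close>, the chosen representative does not matter.\<close>
  define F where "F C = f (SOME x. x \<in> C)" for C
  have F: "F (r `` {v}) = f v" if "v \<in> V" for v
  proof -
    have "v \<in> r `` {v}" using that by (rule equiv_class_self[OF r])
    then have "(SOME x. x \<in> r `` {v}) \<in> r `` {v}" by (rule someI)
    then show ?thesis using congruentD[OF f(1)] by (auto simp: F_def)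
  qed
  have Fe: "F ` ends (qgraph r X) {k, l} = {f k, f l}" if "k \<in> V" "l \<in> V" for k l
    using that by (simp add: qgraph_ends F)
  obtain k l where kl: "e = {k, l}" "k \<in> V" "l \<in> V" using eX X by (metis E_cases subsetD)
  have "f k \<noteq> f l" using f(2)[OF eX] volt_eq_0_iff[OF kl(1), of f] by auto
  then have "F A \<noteq> F B" using Fe[OF kl(2,3)] e(2) kl(1) by auto
  moreover have "F x = F y"
    if e': "e' \<in> edges (qgraph r X) - {e}" and x: "x \<in> ends (qgraph r X) e'" and y: "y \<in> ends (qgraph r X) e'"
    for e' x y
  proof -
    from e' have e'X: "e' \<in> X" "e' \<noteq> e" by (auto simp: qgraph_simps)
    obtain k l where kl: "e' = {k, l}" "k \<in> V" "l \<in> V" using e'X X by (metis E_cases subsetD)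
    have "f k = f l" using f(2)[OF e'X(1)] e'X(2) volt_eq_0_iff[OF kl(1), of f] by auto
    then have "F ` ends (qgraph r X) e' = {f k}" using Fe[OF kl(2,3)] kl(1) by simp
    then show ?thesis using x y by (metis image_eqI singletonD)
  qed
  ultimately show "\<exists>f :: nat set \<Rightarrow> real. f A \<noteq> f B \<and>
      (\<forall>e'\<in>edges (qgraph r X) - {e}. \<forall>x\<in>ends (qgraph r X) e'. \<forall>y\<in>ends (qgraph r X) e'. f x = f y)"
    by blast
qed

text \<open>In an acyclic quotient \<open>e\<close> is a bridge, so the indicator of one side of it
  has voltage on \<open>e\<close> alone. Indicators also provide the integer values.\<close>

lemma acyclic_quotient_dual:
  assumes r: "equiv V r" and X: "X \<subseteq> E" and acyc: "acyclic_mg (qgraph r X)" and e: "e \<in> X"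
  obtains f where "f respects r" "\<And>v. f v \<in> \<int>"
    "\<And>e'. e' \<in> X \<Longrightarrow> volt f e' = (if e' = e then 1 else 0)"
proof -
  obtain k l where kl: "e = {k, l}" "k \<in> V" "l \<in> V" "k < l" using e X by (metis E_cases subsetD)
  have "\<not> (adjacent ((qgraph r X)\<lparr>edges := edges (qgraph r X) - {e}\<rparr>))\<^sup>*\<^sup>* (r `` {k}) (r `` {l})"
  proof (rule acyclic_mg_bridge[OF acyc])
    show "e \<in> edges (qgraph r X)" using e by (simp add: qgraph_simps)
    show "ends (qgraph r X) e = {r `` {k}, r `` {l}}" using kl qgraph_ends by simp
    fix e' assume "e' \<in> edges (qgraph r X)"
    then have "e' \<in> E" using X by (auto simp: qgraph_simps)
    then obtain k l where "e' = {k, l}" "k \<in> V" "l \<in> V" by (rule E_cases)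
    then show "ends (qgraph r X) e' \<subseteq> verts (qgraph r X)"
      using qgraph_ends by (auto simp: qgraph_simps intro!: quotientI)
  qed
  then have nj: "\<not> joined r (X - {e}) k l"
    by (simp add: qgraph_simps(2) qgraph_remove joined_def)
  \<comment> \<open>The side of the smaller end \<open>k\<close> gets the value -1, so that the
    voltage on \<open>e\<close> is +1.\<close>
  define f where "f v = - (of_bool (joined r (X - {e}) k v) :: real)" for v
  have X': "X - {e} \<subseteq> E" using X by blast
  note ind = joined_indicator[OF r X', where u = k]
  have "f respects r" using ind(1) by (auto simp: f_def congruent_def)
  moreover have "f v \<in> \<int>" for v by (simp add: f_def)
  moreover have "volt f e' = (if e' = e then 1 else 0)" if "e' \<in> X" for e'
  proof (cases "e' = e")
    case True
    have "joined r (X - {e}) k k" by (simp add: joined_def)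
    then show ?thesis using True kl nj by (simp add: volt_def f_def)
  next
    case False
    then have "volt f e' = 0" using ind(2)[of e'] that unfolding f_def volt_uminus by simp
    with False show ?thesis by simp
  qed
  ultimately show thesis by (rule that)
qed

text \<open>Zero voltage makes a potential constant on joined vertices; conversely, in a
  disconnected quotient the indicator of a component is not constant.\<close>

lemma connected_quotient_iff:
  assumes r: "equiv V r" and X: "X \<subseteq> E"
  shows "connected_mg (qgraph r X) \<longleftrightarrow>
    (\<forall>g. g respects r \<longrightarrow> (\<forall>e\<in>X. volt g e = 0) \<longrightarrow> (\<forall>u\<in>V. \<forall>v\<in>V. g u = g v))" (is "?L = ?R")
proof -
  have "?L \<longleftrightarrow> (\<forall>u\<in>V. \<forall>v\<in>V. joined r X u v)"
    using V_nonempty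
    by (auto simp: connected_mg_def same_component_def qgraph_simps joined_def quotient_def)
  also have "\<dots> \<longleftrightarrow> ?R"
  proof
    assume "\<forall>u\<in>V. \<forall>v\<in>V. joined r X u v"
    then show ?R using joined_eq[OF r X] by blast
  next
    assume R: ?R
    show "\<forall>u\<in>V. \<forall>v\<in>V. joined r X u v"
    proof (intro ballI)
      fix u v assume uv: "u \<in> V" "v \<in> V"
      note ind = joined_indicator[OF r X, where u = u]
      have "of_bool (joined r X u u) = (of_bool (joined r X u v) :: real)"
        using R[THEN spec, THEN mp, OF ind(1)] ind(2) uv by blast
      moreover have "joined r X u u" by (simp add: joined_def)
      ultimately show "joined r X u v" by (simp add: of_bool_def split: if_splits)
    qed
  qed
  finally show ?thesis .
qed

lemma tree_quotient_iff:
  assumes "equiv V r" "X \<subseteq> E"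
  shows "tree_mg (qgraph r X) \<longleftrightarrow> qtree r X"
proof -
  have "acyclic_mg (qgraph r X) \<longleftrightarrow>
    (\<forall>e\<in>X. \<exists>f. f respects r \<and> (\<forall>e'\<in>X. volt f e' = (if e' = e then 1 else 0)))" (is "?L \<longleftrightarrow> ?R")
  proof
    assume L: ?L
    show ?R
    proof
      fix e assume "e \<in> X"
      then obtain f where "f respects r" "\<And>e'. e' \<in> X \<Longrightarrow> volt f e' = (if e' = e then 1 else 0)"
        using acyclic_quotient_dual[OF assms L] by blast
      then show "\<exists>f. f respects r \<and> (\<forall>e'\<in>X. volt f e' = (if e' = e then 1 else 0))" by blast
    qed
  next
    assume ?R
    then show ?L by (intro acyclic_quotientI[OF assms]) (rule bspec)
  qed
  then show ?thesis
    unfolding tree_mg_def potential_tree_def connected_quotient_iff[OF assms] by (simp only: conj_commute)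
qed

section \<open>Dual bases of trees and flows around cycles\<close>

lemma qtree_const:
  assumes "qtree r X" "g respects r" "\<And>e. e \<in> X \<Longrightarrow> volt g e = 0" "u \<in> V" "v \<in> V"
  shows "g u = g v"
  using assms unfolding potential_tree_def by blast

lemma qtree_volt_0:
  assumes "qtree r X" "g respects r" "\<And>e. e \<in> X \<Longrightarrow> volt g e = 0" "e \<in> E"
  shows "volt g e = 0"
proof -
  obtain k l where kl: "e = {k, l}" "k \<in> V" "l \<in> V" using assms(4) by (rule E_cases)
  then show ?thesis using qtree_const[OF assms(1-3) kl(2,3)] volt_eq_0_iff[OF kl(1)] by simp
qed

text \<open>Integer values are demanded so that flow coefficients, which are voltages of these
  potentials up to sign, become integers.\<close>

definition dual_basis :: "(nat \<times> nat) set \<Rightarrow> nat set set \<Rightarrow> (nat set \<Rightarrow> nat \<Rightarrow> real) \<Rightarrow> bool" where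
  "dual_basis r X f \<longleftrightarrow> (\<forall>e\<in>X. f e respects r \<and> (\<forall>v. f e v \<in> \<int>) \<and>
    (\<forall>e'\<in>X. volt (f e) e' = (if e' = e then 1 else 0)))"

lemma dual_basisD:
  assumes "dual_basis r X f" "e \<in> X"
  shows "f e respects r" "f e v \<in> \<int>"
    and "e' \<in> X \<Longrightarrow> volt (f e) e' = (if e' = e then 1 else 0)"
  using assms unfolding dual_basis_def by blast+

lemma qtree_dual:
  assumes "equiv V r" "X \<subseteq> E" "qtree r X"
  obtains f where "dual_basis r X f"
proof -
  have "acyclic_mg (qgraph r X)"
    using tree_quotient_iff[OF assms(1,2)] assms(3) by (simp add: tree_mg_def)
  then have "\<forall>e\<in>X. \<exists>f. f respects r \<and> (\<forall>v. f v \<in> \<int>) \<and>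
      (\<forall>e'\<in>X. volt f e' = (if e' = e then 1 else 0))"
    using acyclic_quotient_dual[OF assms(1,2)] by (metis (no_types, lifting))
  from bchoice[OF this] that show thesis unfolding dual_basis_def by blast
qed

lemma congruent_diff: "f respects r \<Longrightarrow> g respects r \<Longrightarrow> (\<lambda>x. f x - g x :: real) respects r"
  and congruent_scale: "f respects r \<Longrightarrow> (\<lambda>x. a * f x :: real) respects r"
  and congruent_div: "f respects r \<Longrightarrow> (\<lambda>x. f x / a :: real) respects r"
  by (fastforce simp: congruent_def)+

lemma congruent_sum:
  fixes f :: "'a \<Rightarrow> 'b \<Rightarrow> real"
  shows "(\<And>k. k \<in> A \<Longrightarrow> f k respects r) \<Longrightarrow> (\<lambda>x. \<Sum>k\<in>A. f k x) respects r"
  by (rule congruentI, rule sum.cong[OF refl], rule congruentD)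

text \<open>Dual potentials, combined with the wanted voltages as coefficients, realise these
  voltages on the tree.\<close>

lemma qtree_interpolate:
  assumes "equiv V r" "X \<subseteq> E" "qtree r X"
  shows "\<exists>g. g respects r \<and> (\<forall>e\<in>X. volt g e = volt h e)"
proof -
  obtain f where "dual_basis r X f" using qtree_dual[OF assms] .
  note f = dual_basisD[OF this]
  define g where "g x = (\<Sum>e\<in>X. volt h e * f e x)" for x
  have "g respects r" unfolding g_def by (intro congruent_sum congruent_scale f)
  moreover have "volt g e = volt h e" if e: "e \<in> X" for e
  proof -
    have "volt g e = (\<Sum>e'\<in>X. volt h e' * volt (f e') e)"
      unfolding g_def volt_sum volt_scale ..
    also have "\<dots> = (\<Sum>e'\<in>X. if e' = e then volt h e else 0)"
      using f(3) e by (intro sum.cong) auto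
    finally show ?thesis using e finite_sub_E[OF assms(2)] by simp
  qed
  ultimately show ?thesis by blast
qed

text \<open>Orthogonality to the coboundaries of class-constant potentials is Kirchhoff's current
  law in the quotient; these are the elements of its cycle space.\<close>

definition flow :: "(nat \<times> nat) set \<Rightarrow> nat set set \<Rightarrow> (nat set \<Rightarrow> real) \<Rightarrow> bool" where
  "flow r G z \<longleftrightarrow> (\<forall>g. g respects r \<longrightarrow> (\<Sum>e\<in>G. z e * volt g e) = 0)"

lemma flowD: "flow r G z \<Longrightarrow> g respects r \<Longrightarrow> (\<Sum>e\<in>G. z e * volt g e) = 0"
  by (simp add: flow_def)

text \<open>The flow around the fundamental cycle of \<open>e0\<close>: a tree edge gets minus the
  voltage of its dual potential across \<open>e0\<close>.\<close>

lemma flow_ex: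
  assumes r: "equiv V r" and G: "G \<subseteq> E" and e0: "e0 \<in> G" and T: "qtree r (G - {e0})"
  obtains z where "flow r G z" "z e0 = 1" "\<And>e. e \<in> G \<Longrightarrow> z e \<in> \<int>"
proof -
  have F: "G - {e0} \<subseteq> E" using G by blast
  obtain f where "dual_basis r (G - {e0}) f" using qtree_dual[OF r F T] .
  note f = dual_basisD[OF this]
  define z where "z e = (if e = e0 then 1 else - volt (f e) e0)" for e
  have "flow r G z" unfolding flow_def
  proof (intro allI impI)
    fix g :: "nat \<Rightarrow> real" assume g: "g respects r"
    \<comment> \<open>Subtracting the interpolation of \<open>g\<close> leaves no voltage on the
      tree, hence none on \<open>e0\<close>; this expresses \<open>volt g e0\<close> through the
      tree voltages.\<close>
    define h where "h x = g x - (\<Sum>e\<in>G - {e0}. volt g e * f e x)" for x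
    have h: "volt h e = volt g e - (\<Sum>e'\<in>G - {e0}. volt g e' * volt (f e') e)" for e
      unfolding h_def volt_diff volt_sum volt_scale ..
    have "volt h e0 = 0"
    proof (rule qtree_volt_0[OF T])
      show "h respects r"
        unfolding h_def by (intro congruent_diff g congruent_sum congruent_scale f)
      fix e assume e: "e \<in> G - {e0}"
      have "(\<Sum>e'\<in>G - {e0}. volt g e' * volt (f e') e) = (\<Sum>e'\<in>G - {e0}. if e' = e then volt g e else 0)"
        using f(3) e by (intro sum.cong) auto
      then show "volt h e = 0" using h e finite_sub_E[OF F] by simp
    qed (use e0 G in auto)
    then have "volt g e0 = (\<Sum>e\<in>G - {e0}. volt g e * volt (f e) e0)" using h by simp
    moreover have "(\<Sum>e\<in>G. z e * volt g e) = z e0 * volt g e0 + (\<Sum>e\<in>G - {e0}. z e * volt g e)"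
      using e0 finite_sub_E[OF G] by (rule sum.remove[rotated])
    moreover have "(\<Sum>e\<in>G - {e0}. z e * volt g e) = - (\<Sum>e\<in>G - {e0}. volt g e * volt (f e) e0)"
      by (subst sum_negf[symmetric], intro sum.cong) (auto simp: z_def)
    ultimately show "(\<Sum>e\<in>G. z e * volt g e) = 0" by (simp add: z_def)
  qed
  moreover have "z e \<in> \<int>" if "e \<in> G" for e
    using f(2) that by (auto simp: z_def intro!: volt_Ints)
  ultimately show thesis by (intro that[of z]) (simp_all add: z_def)
qed

lemma sum_two_edges:
  fixes h :: "nat set \<Rightarrow> real"
  assumes "G \<subseteq> E" "a \<in> G" "b \<in> G" "a \<noteq> b" "\<And>e. e \<in> G \<Longrightarrow> e \<noteq> a \<Longrightarrow> e \<noteq> b \<Longrightarrow> h e = 0"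
  shows "sum h G = h a + h b"
proof -
  have "sum h G = sum h {a, b}"
    using assms finite_sub_E[OF assms(1)] by (intro sum.mono_neutral_right) auto
  then show ?thesis using assms(4) by simp
qed

lemma sum_one_edge:
  fixes h :: "nat set \<Rightarrow> real"
  assumes "G \<subseteq> E" "a \<in> G" "\<And>e. e \<in> G \<Longrightarrow> e \<noteq> a \<Longrightarrow> h e = 0"
  shows "sum h G = h a"
proof -
  have "sum h G = sum h {a}"
    using assms finite_sub_E[OF assms(1)] by (intro sum.mono_neutral_right) auto
  then show ?thesis by simp
qed

text \<open>The potential \<open>q\<close> sees only \<open>a\<close>; multiples of it cancel the
  voltages of the \<open>p e\<close> on \<open>a\<close>, which completes the dual
  potentials.\<close>

lemma qtree_insertI:
  assumes q: "q respects r" "volt q a = 1" "\<And>e. e \<in> X \<Longrightarrow> volt q e = 0"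
    and p: "\<And>e. e \<in> X \<Longrightarrow> p e respects r"
      "\<And>e e'. e \<in> X \<Longrightarrow> e' \<in> X \<Longrightarrow> volt (p e) e' = (if e' = e then 1 else 0)"
    and a: "a \<notin> X"
    and conn: "\<And>g u v. g respects r \<Longrightarrow> (\<And>e. e \<in> insert a X \<Longrightarrow> volt g e = 0) \<Longrightarrow>
      u \<in> V \<Longrightarrow> v \<in> V \<Longrightarrow> g u = g v"
  shows "qtree r (insert a X)"
  unfolding potential_tree_def
proof (intro conjI ballI allI impI)
  fix e assume e: "e \<in> insert a X"
  show "\<exists>f. f respects r \<and> (\<forall>e'\<in>insert a X. volt f e' = (if e' = e then 1 else 0))"
  proof (cases "e = a")
    case True
    then have "volt q e' = (if e' = e then 1 else 0)" if "e' \<in> insert a X" for e'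
      using that q(2,3) a by (cases "e' = a") simp_all
    with q(1) show ?thesis by blast
  next
    case False
    define f where "f x = p e x - volt (p e) a * q x" for x
    have eX: "e \<in> X" using e False by simp
    have "f respects r" unfolding f_def by (intro congruent_diff congruent_scale p(1)[OF eX] q(1))
    moreover have "volt f e' = (if e' = e then 1 else 0)" if "e' \<in> insert a X" for e'
      using that q(2,3) p(2)[OF eX] False
      unfolding f_def volt_diff volt_scale by (cases "e' = a") simp_all
    ultimately show ?thesis by blast
  qed
next
  fix g :: "nat \<Rightarrow> real" and u v
  assume "g respects r" "\<forall>e\<in>insert a X. volt g e = 0" "u \<in> V" "v \<in> V"
  then show "g u = g v" by (intro conn[of g]) blast+
qed

text \<open>Exchange property: any edge that carries flow may be left out in place of
  \<open>e0\<close>.\<close>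

lemma flow_support_tree:
  assumes r: "equiv V r" and G: "G \<subseteq> E" and e0: "e0 \<in> G" and T: "qtree r (G - {e0})"
    and z: "flow r G z" "z e0 = 1" and e: "e \<in> G" "z e \<noteq> 0"
  shows "qtree r (G - {e})"
proof (cases "e = e0")
  case True
  then show ?thesis using T by simp
next
  case False
  have F: "G - {e0} \<subseteq> E" using G by blast
  obtain f where "dual_basis r (G - {e0}) f" using qtree_dual[OF r F T] .
  note f = dual_basisD[OF this]
  have eF: "e \<in> G - {e0}" using e False by simp
  \<comment> \<open>The potential dual to \<open>e\<close> has voltage at most on \<open>e\<close>
    and \<open>e0\<close>. Pairing with \<open>z\<close> gives \<open>- z e\<close> on
    \<open>e0\<close>, which is nonzero, so rescaling yields the potential for
    \<open>e0\<close>.\<close>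
  have "(\<Sum>e'\<in>G. z e' * volt (f e) e') = z e * volt (f e) e + z e0 * volt (f e) e0"
    using sum_two_edges[OF G e(1) e0 False, of "\<lambda>e'. z e' * volt (f e) e'"] f(3)[OF eF] by auto
  then have ze: "volt (f e) e0 = - z e"
    using flowD[OF z(1) f(1)[OF eF]] f(3)[OF eF eF] z(2) by simp
  define q where "q x = f e x / volt (f e) e0" for x
  have q: "q respects r" "volt q e0 = 1" "\<And>e'. e' \<in> G - {e0} - {e} \<Longrightarrow> volt q e' = 0"
    using congruent_div[OF f(1)[OF eF], of "volt (f e) e0"] f(3)[OF eF] ze e(2)
    unfolding q_def[abs_def] volt_div by auto
  have "qtree r (insert e0 (G - {e0} - {e}))"
  proof (rule qtree_insertI[OF q, where p = f])
    fix g :: "nat \<Rightarrow> real" and u v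
    assume g: "g respects r" "u \<in> V" "v \<in> V"
      and g0: "\<And>e'. e' \<in> insert e0 (G - {e0} - {e}) \<Longrightarrow> volt g e' = 0"
    \<comment> \<open>Only \<open>e\<close> survives in the pairing with the flow, which forces the
      voltage on \<open>e\<close> to vanish as well.\<close>
    have "(\<Sum>e'\<in>G. z e' * volt g e') = z e * volt g e"
      using g0 by (intro sum_one_edge[OF G e(1)]) simp
    then have "volt g e = 0" using flowD[OF z(1) g(1)] e(2) by simp
    then have "volt g e' = 0" if "e' \<in> G - {e0}" for e' using g0[of e'] that by (cases "e' = e") simp_all
    then show "g u = g v" by (intro qtree_const[OF T g(1) _ g(2,3)])
  qed (use f in simp_all)
  moreover have "insert e0 (G - {e0} - {e}) = G - {e}" using e0 False by blast
  ultimately show ?thesis by simp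
qed

text \<open>Let \<open>y\<close> be the integral flow normalised at \<open>e\<close>. Both flows are
  orthogonal to the potential dual to \<open>e0\<close> in \<open>G - {e}\<close>, which sees at
  most \<open>e0\<close> and \<open>e\<close>; comparing gives \<open>z e * y e0 = 1\<close> in
  integers.\<close>

lemma flow_unit:
  assumes r: "equiv V r" and G: "G \<subseteq> E" and e0: "e0 \<in> G"
    and z: "flow r G z" "z e0 = 1" "z e \<in> \<int>" and e: "e \<in> G" and T: "qtree r (G - {e})"
  shows "z e * z e = 1"
proof (cases "e = e0")
  case True
  then show ?thesis using z by simp
next
  case False
  obtain y where y: "flow r G y" "y e = 1" "\<And>e. e \<in> G \<Longrightarrow> y e \<in> \<int>"
    using flow_ex[OF r G e T] by metis
  have F: "G - {e} \<subseteq> E" using G by blast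
  have e0F: "e0 \<in> G - {e}" using e0 False by auto
  obtain f where f: "f respects r" "\<And>e'. e' \<in> G - {e} \<Longrightarrow> volt f e' = (if e' = e0 then 1 else 0)"
    using qtree_dual[OF r F T] dual_basisD[OF _ e0F] by metis
  have "x e0 + x e * volt f e = 0" if "flow r G x" for x
  proof -
    have "(\<Sum>e'\<in>G. x e' * volt f e') = x e0 * volt f e0 + x e * volt f e"
      using f(2) False by (intro sum_two_edges[OF G e0 e]) auto
    then show ?thesis using flowD[OF that f(1)] f(2)[OF e0F] by simp
  qed
  from this[OF z(1)] this[OF y(1)] have "z e * y e0 = 1"
    using z(2) y(2) by (simp add: add_eq_0_iff)
  then show ?thesis using Ints_mult_eq_1_imp_square z(3) y(3)[OF e0] by blast
qed

section \<open>Superports\<close>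

lemma port_eqI:
  assumes "q \<in> {1..nports N}" "q' \<in> {1..nports N}" "k \<in> port N q" "k \<in> port N q'"
  shows "q = q'"
  using net_disjoint assms unfolding disjoint_family_on_def by blast

lemma port_root_eq:
  assumes "q \<in> {1..nports N}" "k \<in> port N q"
  shows "port_root N k = Max (port N q)"
proof -
  have "(THE S. S \<in> port N ` {1..nports N} \<and> k \<in> S) = port N q"
    using assms port_eqI[OF assms(1) _ assms(2)] by (intro the_equality) blast+
  then show ?thesis by (simp add: port_root_def)
qed

lemma finite_port: "q \<in> {1..nports N} \<Longrightarrow> finite (port N q)"
  using net_port finite_V by (meson finite_subset)

lemma boundary_cases:
  assumes "k \<in> boundary N"
  obtains q where "q \<in> {1..nports N}" "k \<in> port N q" "port_root N k \<in> port N q"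
    "port_root N k \<in> roots N"
proof -
  obtain q where q: "q \<in> {1..nports N}" "k \<in> port N q" using assms by (auto simp: boundary_def)
  have "port_root N k \<in> port N q"
    unfolding port_root_eq[OF q] using finite_port[OF q(1)] q(2) by (intro Max_in) auto
  moreover have "port_root N k \<in> roots N" unfolding port_root_eq[OF q] roots_def using q(1) by blast
  ultimately show thesis using that q by blast
qed

lemma boundary_sub: "boundary N \<subseteq> V"
  using net_port by (auto simp: boundary_def)

lemma port_root_in_V: "k \<in> boundary N \<Longrightarrow> port_root N k \<in> V"
  using boundary_cases net_port by (metis subsetD)

lemma port_root_of_root:
  assumes "k \<in> roots N"
  shows "port_root N k = k"
proof -
  obtain q where q: "q \<in> {1..nports N}" "k = Max (port N q)" using assms by (auto simp: roots_def)
  have "k \<in> port N q" unfolding q(2) using finite_port[OF q(1)] net_port q(1) by (intro Max_in) auto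
  then show ?thesis using port_root_eq[OF q(1)] q(2) by simp
qed

abbreviation "R X \<equiv> port_equiv_off N X"

lemma port_equiv_eq: "port_equiv N = R {}"
  by (simp add: port_equiv_def port_equiv_off_def)

lemma same_port_trans:
  assumes "same_port N u v" "same_port N v w"
  shows "same_port N u w"
proof -
  obtain q q' where "q \<in> {1..nports N}" "u \<in> port N q" "v \<in> port N q"
    "q' \<in> {1..nports N}" "v \<in> port N q'" "w \<in> port N q'"
    using assms unfolding same_port_def by blast
  moreover from this have "q = q'" by (intro port_eqI)
  ultimately show ?thesis unfolding same_port_def by blast
qed

lemma equiv_R: "equiv V (R X)"
proof (rule equivI)
  show "R X \<subseteq> V \<times> V" by (auto simp: port_equiv_off_def)
  show "refl_on V (R X)" by (auto simp: port_equiv_off_def refl_on_def)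
  show "sym (R X)" by (auto simp: port_equiv_off_def sym_def same_port_def)
  show "trans (R X)"
    by (rule transI) (use same_port_trans in \<open>auto simp: port_equiv_off_def\<close>)
qed

lemma R_antimono: "X \<subseteq> Y \<Longrightarrow> R Y \<subseteq> R X"
  by (auto simp: port_equiv_off_def)

lemma respects_mono: "g respects R X \<Longrightarrow> X \<subseteq> Y \<Longrightarrow> g respects R Y"
  using R_antimono unfolding congruent_def by blast

section \<open>Indicators of vertices and jumps between a vertex and its root\<close>

definition \<delta> :: "nat \<Rightarrow> nat \<Rightarrow> real" where
  "\<delta> i v = of_bool (v = i)"

lemma \<delta>_respects: "i \<in> X \<Longrightarrow> \<delta> i respects R X"
  by (rule congruentI) (auto simp: port_equiv_off_def \<delta>_def)

lemma \<delta>_interior_respects: "k \<notin> boundary N \<Longrightarrow> \<delta> k respects R X"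
  by (rule congruentI) (auto simp: port_equiv_off_def \<delta>_def same_port_def boundary_def)

definition jump :: "(nat \<Rightarrow> real) \<Rightarrow> nat \<Rightarrow> real" where
  "jump g i = g i - g (port_root N i)"

lemma jump_diff: "jump (\<lambda>x. f x - g x) i = jump f i - jump g i"
  and jump_scale: "jump (\<lambda>x. a * g x) i = a * jump g i"
  by (simp_all add: jump_def algebra_simps)

lemma jump_sum: "jump (\<lambda>x. \<Sum>k\<in>A. h k x) i = (\<Sum>k\<in>A. jump (h k) i)"
  by (simp add: jump_def sum_subtractf)

text \<open>Roots never lie in \<open>X\<close>, so \<open>R X\<close> still identifies
  \<open>i\<close> with its root.\<close>

lemma jump_eq_0:
  assumes "i \<in> boundary N - roots N" "X \<subseteq> boundary N - roots N" "i \<notin> X" "g respects R X"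
  shows "jump g i = 0"
proof -
  obtain q where q: "q \<in> {1..nports N}" "i \<in> port N q" "port_root N i \<in> port N q"
    "port_root N i \<in> roots N" using assms(1) boundary_cases by blast
  then have "same_port N i (port_root N i)" "i \<in> V" "port_root N i \<in> V" "port_root N i \<notin> X"
    using net_port assms(2) unfolding same_port_def by blast+
  then have "(i, port_root N i) \<in> R X" using assms(3) by (simp add: port_equiv_off_def)
  then show ?thesis using congruentD[OF assms(4)] by (simp add: jump_def)
qed

lemma jump_\<delta>:
  assumes "i \<in> boundary N - roots N" "j \<in> boundary N - roots N"
  shows "jump (\<delta> j) i = of_bool (i = j)"
proof -
  have "port_root N i \<in> roots N" using assms(1) boundary_cases by blast
  then show ?thesis using assms by (auto simp: jump_def \<delta>_def)
qed

text \<open>Subtracting the jump at \<open>i\<close> glues \<open>i\<close> back to its superport.\<close>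

lemma glue_respects:
  assumes i: "i \<in> boundary N - roots N" "insert i X \<subseteq> boundary N - roots N" and g: "g respects R (insert i X)"
  shows "(\<lambda>x. g x - jump g i * \<delta> i x) respects R X"
proof (rule congruentI)
  define h where "h = (\<lambda>x. g x - jump g i * \<delta> i x)"
  obtain q where q: "q \<in> {1..nports N}" "i \<in> port N q" "port_root N i \<in> port N q"
    "port_root N i \<in> roots N" using i(1) boundary_cases by blast
  have root: "port_root N i \<notin> insert i X" "port_root N i \<in> V" using q i(2) net_port by blast+
  \<comment> \<open>At \<open>i\<close> the corrected potential takes the value of the root, which
    \<open>R (insert i X)\<close> identifies with the unsplit vertices of the superport.\<close>
  have hi: "h i = g (port_root N i)" by (simp add: h_def jump_def \<delta>_def)
  have hv: "h v = g v" if "v \<noteq> i" for v using that by (simp add: h_def \<delta>_def)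
  have step: "h i = h v" if "(i, v) \<in> R X" "v \<noteq> i" for v
  proof -
    have v: "v \<notin> insert i X" "v \<in> V" "same_port N i v" using that by (auto simp: port_equiv_off_def)
    have "same_port N (port_root N i) i" using q unfolding same_port_def by blast
    then have "(port_root N i, v) \<in> R (insert i X)"
      using same_port_trans v root by (auto simp: port_equiv_off_def)
    then show ?thesis using congruentD[OF g] hi hv[OF that(2)] by simp
  qed
  fix u v assume uv: "(u, v) \<in> R X"
  then have vu: "(v, u) \<in> R X" using equiv_R[of X] by (meson equivE symD)
  have "h u = h v"
  proof (cases "u = i \<or> v = i")
    case True
    then show ?thesis using step uv vu by (cases "u = v") auto
  next
    case False
    then have "(u, v) \<in> R (insert i X)" using uv by (auto simp: port_equiv_off_def)
    then show ?thesis using congruentD[OF g] hv False by simp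
  qed
  then show "g u - jump g i * \<delta> i u = g v - jump g i * \<delta> i v" by (simp add: h_def)
qed

section \<open>Relative trees and circulations\<close>

lemma acyclic_span_graph:
  assumes F: "F \<subseteq> E" and T: "qtree r F"
  shows "acyclic_mg (span_graph N F)"
proof (rule acyclic_mgI_potential)
  fix e u v assume e: "e \<in> edges (span_graph N F)" "ends (span_graph N F) e = {u, v}"
  then have eF: "e \<in> F" "e = {u, v}" by (simp_all add: span_graph_def)
  obtain f where f: "\<And>e'. e' \<in> F \<Longrightarrow> volt f e' = (if e' = e then 1 else 0)"
    using T[unfolded potential_tree_def, THEN conjunct1, rule_format, OF eF(1)] by auto
  have "volt f e \<noteq> 0" using f[OF eF(1)] by simp
  then have "f u \<noteq> f v" by (simp add: volt_eq_0_iff[OF eF(2)])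
  moreover have "f x = f y" if e': "e' \<in> F - {e}" and xy: "x \<in> e'" "y \<in> e'" for e' x y
  proof -
    have "e' \<in> E" using e' F by blast
    then obtain k l where kl: "e' = {k, l}" by (rule E_cases)
    have "volt f e' = 0" using f[of e'] e' by simp
    then have "f k = f l" by (simp add: volt_eq_0_iff[OF kl])
    then show ?thesis using xy unfolding kl by auto
  qed
  ultimately show "\<exists>f :: nat \<Rightarrow> real. f u \<noteq> f v \<and> (\<forall>e'\<in>edges (span_graph N F) - {e}.
      \<forall>x\<in>ends (span_graph N F) e'. \<forall>y\<in>ends (span_graph N F) e'. f x = f y)"
    unfolding span_graph_def multigraph.simps by blast
qed

lemma valid_iff: "valid N F \<longleftrightarrow> F \<subseteq> E \<and> qtree (R {}) F"
  unfolding valid_def spanning_forest_def port_equiv_eq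
  using tree_quotient_iff[OF equiv_R] acyclic_span_graph by blast

lemma valid_rel_iff: "valid_rel N i F \<longleftrightarrow> F \<subseteq> E \<and> qtree (R {i}) F"
  unfolding valid_rel_def spanning_forest_def
  using tree_quotient_iff[OF equiv_R] acyclic_span_graph by blast

text \<open>The net flow of \<open>z\<close> into \<open>i\<close>. A flow modulo the superports
  balances only over a whole superport, so this may be nonzero at a boundary vertex.\<close>

definition circ :: "nat set set \<Rightarrow> (nat set \<Rightarrow> real) \<Rightarrow> nat \<Rightarrow> real" where
  "circ G z i = (\<Sum>e\<in>G. z e * volt (\<delta> i) e)"

text \<open>Gluing \<open>i\<close> back changes \<open>g\<close> by a multiple of
  \<open>\<delta> i\<close> and makes it orthogonal to \<open>z\<close>; only that multiple
  contributes.\<close>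

lemma flow_single:
  assumes i: "i \<in> boundary N - roots N" and z: "flow (R {}) G z" and g: "g respects R {i}"
  shows "(\<Sum>e\<in>G. z e * volt g e) = jump g i * circ G z i"
proof -
  have "(\<lambda>x. g x - jump g i * \<delta> i x) respects R {}"
    using i g by (intro glue_respects) auto
  from flowD[OF z this] show ?thesis
    unfolding volt_diff volt_scale
    by (simp add: circ_def algebra_simps sum_subtractf sum_distrib_left)
qed

text \<open>Glue \<open>i\<close> back first and then apply the case of a single vertex to
  \<open>j\<close>, where the jump is unchanged.\<close>

lemma flow_pair:
  assumes i: "i \<in> boundary N - roots N" and j: "j \<in> boundary N - roots N" and ij: "i \<noteq> j"
    and z: "flow (R {}) G z" and g: "g respects R {i, j}"
  shows "(\<Sum>e\<in>G. z e * volt g e) = jump g i * circ G z i + jump g j * circ G z j"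
proof -
  define h where "h = (\<lambda>x. g x - jump g i * \<delta> i x)"
  have "h respects R {j}" unfolding h_def using i j g by (intro glue_respects) auto
  from flow_single[OF j z this] have "(\<Sum>e\<in>G. z e * volt h e) = jump h j * circ G z j" .
  moreover have "jump h j = jump g j"
    using jump_\<delta>[OF j i] ij unfolding h_def jump_diff jump_scale by simp
  moreover have "(\<Sum>e\<in>G. z e * volt h e) = (\<Sum>e\<in>G. z e * volt g e) - jump g i * circ G z i"
    unfolding h_def volt_diff volt_scale
    by (simp add: circ_def algebra_simps sum_subtractf sum_distrib_left)
  ultimately show ?thesis by simp
qed

lemma respects_if_jump_0:
  assumes "i \<in> boundary N - roots N" "g respects R {i}" "jump g i = 0"
  shows "g respects R {}"
  using glue_respects[of i "{}" g] assms by simp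

text \<open>Splitting off \<open>i\<close> adds one potential and restoring \<open>e0\<close> adds
  one edge; a nonzero \<open>circ G z i\<close> makes the two match.\<close>

lemma circ_nonzero_imp_tree:
  assumes i: "i \<in> boundary N - roots N" and G: "G \<subseteq> E" and e0: "e0 \<in> G"
    and T: "qtree (R {}) (G - {e0})" and z: "flow (R {}) G z" "z e0 = 1" and nz: "circ G z i \<noteq> 0"
  shows "qtree (R {i}) G"
proof -
  have F: "G - {e0} \<subseteq> E" using G by blast
  obtain f where "dual_basis (R {}) (G - {e0}) f" using qtree_dual[OF equiv_R F T] .
  note f = dual_basisD[OF this]
  obtain p where p: "p respects R {}" "\<forall>e\<in>G - {e0}. volt p e = volt (\<delta> i) e"
    using qtree_interpolate[OF equiv_R F T] by blast
  \<comment> \<open>\<open>h\<close> is \<open>\<delta> i\<close> with its voltages on the tree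
    removed. Only \<open>e0\<close> is left, and the flow reads off \<open>circ G z i\<close>
    there.\<close>
  define h where "h x = \<delta> i x - p x" for x
  have h: "h respects R {i}" unfolding h_def
    by (intro congruent_diff \<delta>_respects respects_mono[OF p(1)]) auto
  have h0: "volt h e = 0" if "e \<in> G - {e0}" for e using p(2) that unfolding h_def volt_diff by simp
  have "jump h i = 1"
    using jump_\<delta>[OF i i] jump_eq_0[OF i _ _ p(1)] unfolding h_def jump_diff by simp
  then have "(\<Sum>e\<in>G. z e * volt h e) = circ G z i" using flow_single[OF i z(1) h] by simp
  moreover have "(\<Sum>e\<in>G. z e * volt h e) = z e0 * volt h e0"
    using h0 by (intro sum_one_edge[OF G e0]) simp
  ultimately have he0: "volt h e0 = circ G z i" using z(2) by simp
  have "qtree (R {i}) (insert e0 (G - {e0}))"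
  proof (rule qtree_insertI[where q = "\<lambda>x. h x / circ G z i" and p = f])
    show "(\<lambda>x. h x / circ G z i) respects R {i}" by (rule congruent_div[OF h])
    show "volt (\<lambda>x. h x / circ G z i) e0 = 1" using he0 nz by (simp add: volt_div)
    show "volt (\<lambda>x. h x / circ G z i) e = 0" if "e \<in> G - {e0}" for e
      using h0[OF that] by (simp add: volt_div)
    show "f e respects R {i}" if "e \<in> G - {e0}" for e using f(1)[OF that] respects_mono by blast
    show "volt (f e) e' = (if e' = e then 1 else 0)" if "e \<in> G - {e0}" "e' \<in> G - {e0}" for e e'
      using f(3)[OF that] .
    fix g :: "nat \<Rightarrow> real" and u v
    assume g: "g respects R {i}" "u \<in> V" "v \<in> V"
      and g0: "\<And>e. e \<in> insert e0 (G - {e0}) \<Longrightarrow> volt g e = 0"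
    \<comment> \<open>Without voltage on \<open>G\<close> the potential cannot jump at
      \<open>i\<close>, so it is class-constant and \<open>T\<close> applies.\<close>
    have "jump g i * circ G z i = 0"
      using g0 flow_single[OF i z(1) g(1)] by (auto intro!: sum.neutral)
    then have "g respects R {}" using nz by (intro respects_if_jump_0[OF i g(1)]) simp
    then show "g u = g v" by (rule qtree_const[OF T _ _ g(2,3)]) (use g0 in simp)
  qed simp
  moreover have "insert e0 (G - {e0}) = G" using e0 by blast
  ultimately show ?thesis by simp
qed

text \<open>Pairing \<open>z\<close> with the potential dual to \<open>e0\<close> in
  \<open>G\<close> shows that \<open>circ G z i\<close> times the jump of this potential at
  \<open>i\<close> is 1, and both are integers.\<close>

lemma tree_imp_circ_unit:
  assumes i: "i \<in> boundary N - roots N" and G: "G \<subseteq> E" and e0: "e0 \<in> G"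
    and z: "flow (R {}) G z" "z e0 = 1" "\<And>e. e \<in> G \<Longrightarrow> z e \<in> \<int>" and T: "qtree (R {i}) G"
  shows "circ G z i * circ G z i = 1"
    and "\<exists>f. f respects R {i} \<and> (\<forall>e\<in>G. volt f e = (if e = e0 then 1 else 0)) \<and> jump f i \<noteq> 0"
proof -
  obtain f where "dual_basis (R {i}) G f" using qtree_dual[OF equiv_R G T] .
  note f = dual_basisD[OF this e0]
  have "(\<Sum>e\<in>G. z e * volt (f e0) e) = z e0 * volt (f e0) e0"
    using f(3) by (intro sum_one_edge[OF G e0]) simp
  then have 1: "circ G z i * jump (f e0) i = 1"
    using flow_single[OF i z(1) f(1)] f(3)[OF e0] z(2) by (simp add: mult.commute)
  have "circ G z i \<in> \<int>"
    unfolding circ_def by (intro Ints_sum Ints_mult z(3) volt_Ints) (auto simp: \<delta>_def)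
  moreover have "jump (f e0) i \<in> \<int>" using f(2) by (simp add: jump_def)
  ultimately show "circ G z i * circ G z i = 1" using 1 by (rule Ints_mult_eq_1_imp_square)
  have "jump (f e0) i \<noteq> 0" using 1 by auto
  then show "\<exists>f. f respects R {i} \<and> (\<forall>e\<in>G. volt f e = (if e = e0 then 1 else 0)) \<and> jump f i \<noteq> 0"
    using f(1,3) by blast
qed

text \<open>Some dual potential must jump at \<open>i\<close>, and its edge is the one to remove:
  multiples of it cancel the jumps of the others.\<close>

lemma relative_tree_remove_edge:
  assumes i: "i \<in> boundary N - roots N" and G: "G \<subseteq> E" and T: "qtree (R {i}) G"
  obtains e0 where "e0 \<in> G" "qtree (R {}) (G - {e0})"
proof -
  obtain f where "dual_basis (R {i}) G f" using qtree_dual[OF equiv_R G T] .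
  note f = dual_basisD[OF this]
  obtain a where a: "a \<in> G" "jump (f a) i \<noteq> 0"
  proof (rule ccontr)
    assume "\<not> thesis"
    then have none: "\<And>e. e \<in> G \<Longrightarrow> jump (f e) i = 0" using that by blast
    have respects: "f e respects R {}" if "e \<in> G" for e
      using respects_if_jump_0[OF i f(1)[OF that] none[OF that]] .
    \<comment> \<open>If no dual potential jumps, \<open>h\<close> has no voltage on
      \<open>G\<close> and so is constant on \<open>V\<close>, yet it jumps by 1 at
      \<open>i\<close>.\<close>
    define h where "h x = \<delta> i x - (\<Sum>e\<in>G. volt (\<delta> i) e * f e x)" for x
    have "h i = h (port_root N i)"
    proof (rule qtree_const[OF T])
      show "h respects R {i}"
        unfolding h_def by (intro congruent_diff \<delta>_respects congruent_sum congruent_scale f) simp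
      fix e assume e: "e \<in> G"
      have "(\<Sum>e'\<in>G. volt (\<delta> i) e' * volt (f e') e) = volt (\<delta> i) e * volt (f e) e"
        using e f(3) by (intro sum_one_edge[OF G]) auto
      then show "volt h e = 0"
        unfolding h_def volt_diff volt_sum volt_scale using f(3)[OF e e] by simp
    next
      show "i \<in> V" using i boundary_sub by blast
      show "port_root N i \<in> V" using i by (intro port_root_in_V) simp
    qed
    moreover have "jump h i = 1"
      using jump_\<delta>[OF i i] none unfolding h_def jump_diff jump_sum jump_scale by simp
    ultimately show False by (simp add: jump_def)
  qed
  have "qtree (R {}) (G - {a})" unfolding potential_tree_def
  proof (intro conjI ballI allI impI)
    fix e assume e: "e \<in> G - {a}"
    then have eG: "e \<in> G" by simp
    define p where "p x = f e x - jump (f e) i / jump (f a) i * f a x" for x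
    have "p respects R {i}" unfolding p_def by (intro congruent_diff congruent_scale f a eG)
    moreover have "jump p i = 0" using a(2) unfolding p_def jump_diff jump_scale by simp
    ultimately have "p respects R {}" by (rule respects_if_jump_0[OF i])
    moreover have "volt p e' = (if e' = e then 1 else 0)" if "e' \<in> G - {a}" for e'
      using that f(3)[OF eG, of e'] f(3)[OF a(1), of e'] unfolding p_def volt_diff volt_scale by simp
    ultimately show "\<exists>f. f respects R {} \<and> (\<forall>e'\<in>G - {a}. volt f e' = (if e' = e then 1 else 0))"
      by blast
  next
    fix g :: "nat \<Rightarrow> real" and u v
    assume g: "g respects R {}" and g0: "\<forall>e\<in>G - {a}. volt g e = 0" and uv: "u \<in> V" "v \<in> V"
    have gi: "g respects R {i}" using respects_mono[OF g] by simp
    \<comment> \<open>\<open>h\<close> is constant on \<open>V\<close>. Neither \<open>h\<close> nor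
      \<open>g\<close> jumps at \<open>i\<close>, but \<open>f a\<close> does, so its coefficient
      \<open>volt g a\<close> is zero.\<close>
    define h where "h x = g x - volt g a * f a x" for x
    have "h i = h (port_root N i)"
    proof (rule qtree_const[OF T])
      show "h respects R {i}" unfolding h_def by (intro congruent_diff congruent_scale gi f a)
      fix e assume "e \<in> G"
      then show "volt h e = 0"
        using g0 f(3)[OF a(1), of e] unfolding h_def volt_diff volt_scale by (cases "e = a") auto
    next
      show "i \<in> V" using i boundary_sub by blast
      show "port_root N i \<in> V" using i by (intro port_root_in_V) simp
    qed
    then have "jump h i = 0" by (simp add: jump_def)
    moreover have "jump g i = 0" using i g by (intro jump_eq_0[of i "{}"]) auto
    ultimately have "volt g a = 0" using a(2) unfolding h_def jump_diff jump_scale by simp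
    then have "volt g e = 0" if "e \<in> G" for e using g0 that by (cases "e = a") simp_all
    then show "g u = g v" by (rule qtree_const[OF T gi _ uv])
  qed
  with a(1) show thesis by (rule that)
qed

text \<open>Pairing \<open>z\<close> with the indicator \<open>t\<close> of the component of
  \<open>i\<close> modulo the \<open>{i, j}\<close>-equivalence relates \<open>circ G z i\<close> to
  \<open>circ G z j\<close>; membership of \<open>j\<close> in that component fixes the
  sign.\<close>

lemma forest_sgn_eq:
  assumes i: "i \<in> boundary N - roots N" and j: "j \<in> boundary N - roots N" and G: "G \<subseteq> E"
    and e0: "e0 \<in> G" and T0: "qtree (R {}) (G - {e0})"
    and z: "flow (R {}) G z" "z e0 = 1" "\<And>e. e \<in> G \<Longrightarrow> z e \<in> \<int>"
    and T: "qtree (R {i}) G" "qtree (R {j}) G"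
  shows "circ G z i * circ G z j = forest_sgn N G i j"
proof (cases "i = j")
  case True
  then show ?thesis using tree_imp_circ_unit(1)[OF i G e0 z T(1)] by (simp add: forest_sgn_def)
next
  case False
  have V: "i \<in> V" "j \<in> V" using i j boundary_sub by blast+
  have sgn: "forest_sgn N G i j = (if joined (R {i, j}) G i j then - 1 else 1)"
    using False V
    by (simp add: forest_sgn_def Let_def same_component_def joined_def qgraph_simps quotientI)
  define t where "t = (\<lambda>v. of_bool (joined (R {i, j}) G i v) :: real)"
  have t: "t respects R {i, j}" "\<And>e. e \<in> G \<Longrightarrow> volt t e = 0"
    using joined_indicator[OF equiv_R G] by (auto simp: t_def)
  have t01: "t v = 0 \<or> t v = 1" for v by (simp add: t_def)
  have ti: "t i = 1" by (simp add: t_def joined_def)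
  note ui = tree_imp_circ_unit[OF i G e0 z T(1)] and uj = tree_imp_circ_unit[OF j G e0 z T(2)]
  have 0: "jump t i * circ G z i + jump t j * circ G z j = 0"
    using flow_pair[OF i j False z(1) t(1)] t(2) by simp
  \<comment> \<open>Otherwise \<open>t\<close> respects all superports and is constantly 1 on
    \<open>V\<close>, so all vertices are joined. The potentials dual to \<open>e0\<close> for
    \<open>i\<close> and for \<open>j\<close> then have the same jump at \<open>i\<close>, but only
    the former jumps there.\<close>
  have "jump t i \<noteq> 0"
  proof
    assume ji: "jump t i = 0"
    have cj: "circ G z j \<noteq> 0" using uj(1) by auto
    then have jj: "jump t j = 0" using 0 ji by simp
    have "(\<lambda>x. t x - jump t i * \<delta> i x) respects R {j}"
      using i j t(1) by (intro glue_respects) auto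
    then have "t respects R {j}" using ji by simp
    then have t0: "t respects R {}" using jj by (intro respects_if_jump_0[OF j])
    have "t u = 1" if "u \<in> V" for u using qtree_const[OF T0 t0 _ that V(1)] t(2) ti by simp
    then have conn: "joined (R {i, j}) G i u" if "u \<in> V" for u using that by (auto simp: t_def)
    obtain f where f: "f respects R {i}" "\<forall>e\<in>G. volt f e = (if e = e0 then 1 else 0)" "jump f i \<noteq> 0"
      using ui(2) by blast
    obtain g where g: "g respects R {j}" "\<forall>e\<in>G. volt g e = (if e = e0 then 1 else 0)"
      using uj(2) by blast
    define h where "h x = f x - g x" for x
    have root: "port_root N i \<in> V" using i by (intro port_root_in_V) simp
    have "h i = h (port_root N i)"
    proof (rule joined_eq[OF equiv_R G conn[OF root] V(1) root])
      show "h respects R {i, j}" unfolding h_def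
        by (intro congruent_diff respects_mono[OF f(1)] respects_mono[OF g(1)]) auto
    qed (use f(2) g(2) in \<open>simp add: h_def[abs_def] volt_diff\<close>)
    then have "jump h i = 0" by (simp add: jump_def)
    moreover have "jump g i = 0" using False j by (intro jump_eq_0[OF i _ _ g(1)]) auto
    ultimately show False using f(3) unfolding h_def jump_diff by simp
  qed
  then have "jump t i = 1" using t01[of "port_root N i"] ti by (auto simp: jump_def)
  then have sum0: "circ G z i + jump t j * circ G z j = 0" using 0 by simp
  \<comment> \<open>Since \<open>t\<close> only takes the values 0 and 1, a nonzero jump at
    \<open>j\<close> is 1 if \<open>j\<close> lies in the component and -1 otherwise.\<close>
  then have "jump t j \<noteq> 0" using ui(1) by auto
  show ?thesis
  proof (cases "joined (R {i, j}) G i j")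
    case True
    then have "t j = 1" by (simp add: t_def)
    then have "jump t j = 1" using \<open>jump t j \<noteq> 0\<close> t01[of "port_root N j"] by (auto simp: jump_def)
    then have "circ G z i = - circ G z j" using sum0 by simp
    then show ?thesis using True sgn uj(1) by simp
  next
    case False
    then have "t j = 0" by (simp add: t_def)
    then have "jump t j = - 1" using \<open>jump t j \<noteq> 0\<close> t01[of "port_root N j"] by (auto simp: jump_def)
    then have "circ G z i = circ G z j" using sum0 by simp
    then show ?thesis using False sgn uj(1) by simp
  qed
qed


section \<open>Currents and voltages\<close>

abbreviation "c \<equiv> conductance N"

text \<open>A smallest edge set that still forces potentials to be constant is a tree: dropping an
  edge frees a potential with voltage on that edge alone, which is rescaled to a dual one.\<close>

lemma spanning_tree_exists: "\<exists>F\<subseteq>E. qtree (R {}) F"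
proof -
  define C where "C X \<longleftrightarrow> (\<forall>g. g respects R {} \<longrightarrow> (\<forall>e\<in>X. volt g e = 0) \<longrightarrow> (\<forall>u\<in>V. \<forall>v\<in>V. g u = g v))" for X
  have "C E" unfolding C_def
  proof (intro allI impI ballI)
    fix g :: "nat \<Rightarrow> real" and u v
    assume g0: "\<forall>e\<in>E. volt g e = 0" and uv: "u \<in> V" "v \<in> V"
    have "(adjacent (span_graph N E))\<^sup>*\<^sup>* u v"
      using net_connected uv by (simp add: connected_mg_def same_component_def span_graph_def)
    then show "g u = g v"
    proof (induction rule: rtranclp_induct)
      case (step x y)
      then have "{x, y} \<in> E" by (auto simp: adjacent_def span_graph_def)
      then have "g x = g y" using g0 volt_eq_0_iff[of "{x, y}" x y g] by blast
      then show ?case using step.IH by simp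
    qed simp
  qed
  then obtain X where X: "X \<subseteq> E" "C X" and min: "\<And>Y. Y \<subseteq> E \<Longrightarrow> C Y \<Longrightarrow> card X \<le> card Y"
    using ex_has_least_nat[of "\<lambda>X. X \<subseteq> E \<and> C X" E card] by blast
  have "\<exists>f. f respects R {} \<and> (\<forall>e'\<in>X. volt f e' = (if e' = e then 1 else 0))" if e: "e \<in> X" for e
  proof -
    have "card (X - {e}) < card X" using e finite_sub_E[OF X(1)] by (intro card_Diff1_less)
    then have "\<not> C (X - {e})" using min[of "X - {e}"] X(1) by fastforce
    then obtain g where g: "g respects R {}" "\<forall>e'\<in>X - {e}. volt g e' = 0" "\<not> (\<forall>u\<in>V. \<forall>v\<in>V. g u = g v)"
      unfolding C_def by blast
    have "volt g e \<noteq> 0" using X(2) g unfolding C_def by (metis DiffI singletonD)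
    then have "volt (\<lambda>x. g x / volt g e) e' = (if e' = e then 1 else 0)" if "e' \<in> X" for e'
      using g(2) that unfolding volt_div by simp
    then show ?thesis using congruent_div[OF g(1)] by blast
  qed
  then have "qtree (R {}) X" using X(2) unfolding potential_tree_def C_def by blast
  then show ?thesis using X(1) by blast
qed

text \<open>Summation by parts: each edge occurs in both directions, and the two terms combine to a
  product of differences.\<close>

lemma sum_net_current:
  assumes I: "\<And>k l. k \<in> V \<Longrightarrow> l \<in> V \<Longrightarrow> I k l = cond N k l * (U k - U l)"
  shows "(\<Sum>k\<in>V. h k * net_current N I k) = (\<Sum>e\<in>E. c e * volt h e * volt U e)"
proof -
  define P where "P = {(k, l) \<in> V \<times> V. {k, l} \<in> E}"
  define L where "L = {(k, l) \<in> V \<times> V. {k, l} \<in> E \<and> k < l}"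
  define t where "t k l = c {k, l} * (h k * (U k - U l))" for k l
  have finL: "finite L" unfolding L_def by (rule finite_subset[of _ "V \<times> V"]) (auto simp: finite_V)
  have P: "P = L \<union> prod.swap ` L"
  proof (intro set_eqI iffI)
    fix x assume "x \<in> P"
    then obtain k l where kl: "x = (k, l)" "k \<in> V" "l \<in> V" "{k, l} \<in> E" by (auto simp: P_def)
    then have "k \<noteq> l" using E_cases[OF kl(4)] by (metis doubleton_eq_iff less_irrefl)
    then have "(k, l) \<in> L \<or> (l, k) \<in> L"
      using kl by (cases "k < l") (simp_all add: L_def insert_commute)
    then show "x \<in> L \<union> prod.swap ` L" using kl(1) by (auto intro: image_eqI[where x = "(l, k)"])
  qed (auto simp: P_def L_def insert_commute)
  have "(\<Sum>k\<in>V. h k * net_current N I k) = (\<Sum>k\<in>V. \<Sum>l\<in>V. if {k, l} \<in> E then t k l else 0)"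
    unfolding net_current_def sum_distrib_left
    by (intro sum.cong refl) (simp add: I cond_def t_def)
  also have "\<dots> = (\<Sum>(k, l)\<in>V \<times> V. if {k, l} \<in> E then t k l else 0)"
    by (simp add: sum.cartesian_product)
  also have "\<dots> = (\<Sum>(k, l)\<in>P. t k l)"
    unfolding P_def by (rule sum.mono_neutral_cong_right) (auto simp: finite_V split: if_splits)
  also have "\<dots> = (\<Sum>(k, l)\<in>L. t k l) + (\<Sum>(k, l)\<in>prod.swap ` L. t k l)"
    unfolding P by (rule sum.union_disjoint) (use finL in \<open>auto simp: L_def\<close>)
  also have "(\<Sum>(k, l)\<in>prod.swap ` L. t k l) = (\<Sum>(k, l)\<in>L. t l k)"
    by (subst sum.reindex) (auto simp: case_prod_beta)
  also have "(\<Sum>(k, l)\<in>L. t k l) + (\<Sum>(k, l)\<in>L. t l k) = (\<Sum>(k, l)\<in>L. c {k, l} * (h k - h l) * (U k - U l))"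
    unfolding sum.distrib[symmetric]
    by (intro sum.cong refl) (auto simp: t_def insert_commute algebra_simps)
  also have "\<dots> = (\<Sum>e\<in>E. c e * volt h e * volt U e)"
  proof (rule sum.reindex_bij_witness[where i = "\<lambda>e. (Min e, Max e)" and j = "\<lambda>(k, l). {k, l}"])
    fix e assume "e \<in> E"
    then obtain k l where "e = {k, l}" "k \<in> V" "l \<in> V" "k < l" by (rule E_cases)
    then show "(case (Min e, Max e) of (k, l) \<Rightarrow> {k, l}) = e" "(Min e, Max e) \<in> L"
      using \<open>e \<in> E\<close> by (auto simp: L_def)
  qed (auto simp: L_def volt_def algebra_simps)
  finally show ?thesis .
qed

text \<open>For the last superport the balance follows from the others, because the total current
  vanishes: take \<open>h = 1\<close> in \<open>sum_net_current\<close>.\<close>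

lemma solution_sum_port:
  assumes sol: "solution N D U I" and q: "q \<in> {1..nports N}"
  shows "(\<Sum>k\<in>port N q. net_current N I k) = 0"
proof (cases "q < nports N")
  case True
  then show ?thesis using sol q by (simp add: solution_def)
next
  case False
  then have "q = nports N" using q by simp
  let ?S = "\<lambda>q. \<Sum>k\<in>port N q. net_current N I k"
  have "(\<Sum>k\<in>V. net_current N I k) = (\<Sum>k\<in>V. 1 * net_current N I k)" by simp
  also have "\<dots> = 0" using sol by (subst sum_net_current[of I U]) (auto simp: solution_def volt_def)
  also have "(\<Sum>k\<in>V. net_current N I k) = (\<Sum>k\<in>V - boundary N. net_current N I k) + (\<Sum>k\<in>boundary N. net_current N I k)"
    by (rule sum.subset_diff[OF boundary_sub finite_V])
  also have "(\<Sum>k\<in>V - boundary N. net_current N I k) = 0"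
    using sol by (intro sum.neutral) (simp add: solution_def)
  also have "(\<Sum>k\<in>boundary N. net_current N I k) = (\<Sum>q\<in>{1..nports N}. ?S q)"
    unfolding boundary_def using port_eqI finite_port by (intro sum.UNION_disjoint) blast+
  also have "\<dots> = ?S q + (\<Sum>q\<in>{1..nports N} - {q}. ?S q)"
    using q by (intro sum.remove) auto
  also have "(\<Sum>q\<in>{1..nports N} - {q}. ?S q) = 0"
    using sol \<open>q = nports N\<close> by (intro sum.neutral) (auto simp: solution_def)
  finally show ?thesis by simp
qed

text \<open>Weak form of current conservation: a class-constant factor can be pulled out of each
  superport, whose currents cancel.\<close>

lemma solution_sum_class:
  assumes sol: "solution N D U I" and h: "h respects R {}"
  shows "(\<Sum>k\<in>V. h k * net_current N I k) = 0"
proof -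
  have "(\<Sum>k\<in>V. h k * net_current N I k) =
      (\<Sum>k\<in>V - boundary N. h k * net_current N I k) + (\<Sum>k\<in>boundary N. h k * net_current N I k)"
    by (rule sum.subset_diff[OF boundary_sub finite_V])
  also have "(\<Sum>k\<in>V - boundary N. h k * net_current N I k) = 0"
    using sol by (intro sum.neutral) (simp add: solution_def)
  also have "(\<Sum>k\<in>boundary N. h k * net_current N I k) =
      (\<Sum>q\<in>{1..nports N}. \<Sum>k\<in>port N q. h k * net_current N I k)"
    unfolding boundary_def using port_eqI finite_port by (intro sum.UNION_disjoint) blast+
  also have "\<dots> = (\<Sum>q\<in>{1..nports N}. h (Max (port N q)) * (\<Sum>k\<in>port N q. net_current N I k))"
  proof (intro sum.cong refl)
    fix q assume q: "q \<in> {1..nports N}"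
    have "Max (port N q) \<in> port N q" using finite_port[OF q] net_port q by (intro Max_in) auto
    then have "(k, Max (port N q)) \<in> R {}" if "k \<in> port N q" for k
      using that q net_port unfolding port_equiv_off_def same_port_def by blast
    then have "h k = h (Max (port N q))" if "k \<in> port N q" for k using congruentD[OF h] that by blast
    then show "(\<Sum>k\<in>port N q. h k * net_current N I k) = h (Max (port N q)) * (\<Sum>k\<in>port N q. net_current N I k)"
      unfolding sum_distrib_left by (intro sum.cong) simp_all
  qed
  also have "\<dots> = 0" using solution_sum_port[OF sol] by (intro sum.neutral) simp
  finally show ?thesis by simp
qed

text \<open>The difference \<open>d\<close> of the voltages has no jumps, so it is an admissible
  test function for itself and its energy is zero. Positive conductances then leave no voltage on
  any edge.\<close>

lemma solution_unique:
  assumes sol: "solution N D U I" and sol': "solution N D U' I'" and k: "k \<in> V"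
  shows "net_current N I k = net_current N I' k"
proof -
  define d where "d x = U x - U' x" for x
  have jump: "d x = d (port_root N x)" if "x \<in> boundary N" for x
  proof (cases "x \<in> roots N")
    case True
    then show ?thesis by (simp add: port_root_of_root)
  next
    case False
    then have "U x - U (port_root N x) = U' x - U' (port_root N x)"
      using sol sol' that by (simp add: solution_def)
    then show ?thesis by (simp add: d_def)
  qed
  have d: "d respects R {}"
  proof (rule congruentI)
    fix u v assume "(u, v) \<in> R {}"
    then consider "u = v" | q where "q \<in> {1..nports N}" "u \<in> port N q" "v \<in> port N q"
      unfolding port_equiv_off_def same_port_def by blast
    then show "d u = d v"
    proof cases
      case 2
      then have "u \<in> boundary N" "v \<in> boundary N" by (auto simp: boundary_def)
      then show ?thesis using jump[of u] jump[of v] 2 port_root_eq by simp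
    qed simp
  qed
  have I: "I k l = cond N k l * (U k - U l)" "I' k l = cond N k l * (U' k - U' l)" if "k \<in> V" "l \<in> V" for k l
    using sol sol' that by (simp_all add: solution_def)
  have "(\<Sum>e\<in>E. c e * volt d e * volt d e) =
      (\<Sum>e\<in>E. c e * volt d e * volt U e) - (\<Sum>e\<in>E. c e * volt d e * volt U' e)"
    unfolding sum_subtractf[symmetric] by (intro sum.cong refl) (simp add: d_def volt_def algebra_simps)
  also have "\<dots> = 0"
    using solution_sum_class[OF sol d] solution_sum_class[OF sol' d]
      sum_net_current[of I U d] sum_net_current[of I' U' d] I by simp
  finally have sum0: "(\<Sum>e\<in>E. c e * volt d e * volt d e) = 0" .
  have nonneg: "0 \<le> c e * volt d e * volt d e" if "e \<in> E" for e
    using net_pos that by (simp add: mult.assoc less_imp_le)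
  have "\<forall>e\<in>E. c e * volt d e * volt d e = 0"
    using sum_nonneg_eq_0_iff[of E "\<lambda>e. c e * volt d e * volt d e"] finite_E nonneg sum0 by blast
  then have d0: "\<forall>e\<in>E. volt d e = 0" using net_pos by fastforce
  have "I k l = I' k l" if l: "l \<in> V" for l
  proof (cases "{k, l} \<in> E")
    case True
    then have "d k = d l" using d0 volt_eq_0_iff[of "{k, l}" k l d] by blast
    then have "U k - U l = U' k - U' l" by (simp add: d_def)
    then show ?thesis using I[OF k l] by simp
  next
    case False
    then show ?thesis using I[OF k l] by (simp add: cond_def)
  qed
  then show ?thesis by (simp add: net_current_def)
qed

text \<open>
  The potential that agrees with \<open>\<delta> j\<close> up to a function on the quotient and for which no current
  flows through the edges of the tree \<open>F\<close>. The actual voltages are the average of these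
  potentials over all trees, taken with the weights of the trees.
\<close>

definition tree_potential :: "nat \<Rightarrow> nat set set \<Rightarrow> nat \<Rightarrow> real" where
  "tree_potential j F =
     (SOME U. (\<lambda>x. \<delta> j x - U x) respects R {} \<and> (\<forall>e\<in>F. volt U e = 0))"

lemma tree_potential:
  assumes F: "F \<subseteq> E" "qtree (R {}) F"
  shows "(\<lambda>x. \<delta> j x - tree_potential j F x) respects R {}" "e \<in> F \<Longrightarrow> volt (tree_potential j F) e = 0"
proof -
  obtain p where p: "p respects R {}" "\<forall>e\<in>F. volt p e = volt (\<delta> j) e"
    using qtree_interpolate[OF equiv_R F] by blast
  have "(\<lambda>x. \<delta> j x - (\<delta> j x - p x)) respects R {} \<and> (\<forall>e\<in>F. volt (\<lambda>x. \<delta> j x - p x) e = 0)"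
    using p by (simp add: volt_diff)
  then have "\<exists>U. (\<lambda>x. \<delta> j x - U x) respects R {} \<and> (\<forall>e\<in>F. volt U e = 0)" by (rule exI[of _ "\<lambda>x. \<delta> j x - p x"])
  from someI_ex[OF this]
  show "(\<lambda>x. \<delta> j x - tree_potential j F x) respects R {}" "e \<in> F \<Longrightarrow> volt (tree_potential j F) e = 0"
    unfolding tree_potential_def[symmetric] by blast+
qed

text \<open>These are the ways to split \<open>G\<close> into a valid forest and one extra edge. If
  there are any, they are the edges of the cycle of \<open>G\<close> modulo the superports.\<close>

definition tree_edges :: "nat set set \<Rightarrow> nat set set" where
  "tree_edges G = {e \<in> G. qtree (R {}) (G - {e})}"

text \<open>The potential of \<open>G - {e}\<close> has voltage in \<open>G\<close> at most on
  \<open>e\<close> and pairs with \<open>z\<close> as \<open>\<delta> j\<close> does;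
  \<open>z e * z e = 1\<close> then determines that voltage.\<close>

lemma sum_tree_edges:
  assumes G: "G \<subseteq> E" and e0: "e0 \<in> G" and T: "qtree (R {}) (G - {e0})"
    and z: "flow (R {}) G z" "z e0 = 1" "\<And>e. e \<in> G \<Longrightarrow> z e \<in> \<int>"
  shows "(\<Sum>e\<in>tree_edges G. volt h e * volt (tree_potential j (G - {e})) e) =
    circ G z j * (\<Sum>e\<in>G. z e * volt h e)"
proof -
  have *: "volt (tree_potential j (G - {e})) e = circ G z j * z e" if "e \<in> tree_edges G" for e
  proof -
    have e: "e \<in> G" "qtree (R {}) (G - {e})" using that by (auto simp: tree_edges_def)
    let ?U = "tree_potential j (G - {e})"
    have "G - {e} \<subseteq> E" using G by blast
    note U = tree_potential[OF this e(2), where j = j]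
    have "z e * volt ?U e = (\<Sum>e'\<in>G. z e' * volt ?U e')"
      using U(2) by (intro sum_one_edge[OF G e(1), symmetric]) simp
    also have "\<dots> = circ G z j"
      using flowD[OF z(1) U(1)] unfolding volt_diff
      by (simp add: circ_def right_diff_distrib sum_subtractf)
    finally have "z e * z e * volt ?U e = circ G z j * z e" by simp
    then show ?thesis using flow_unit[OF equiv_R G e0 z(1,2) z(3)[OF e(1)] e] by simp
  qed
  have "(\<Sum>e\<in>tree_edges G. volt h e * volt (tree_potential j (G - {e})) e) =
      (\<Sum>e\<in>tree_edges G. circ G z j * (z e * volt h e))"
    using * by (intro sum.cong) simp_all
  also have "\<dots> = (\<Sum>e\<in>G. circ G z j * (z e * volt h e))"
  proof (rule sum.mono_neutral_left)
    show "\<forall>e\<in>G - tree_edges G. circ G z j * (z e * volt h e) = 0"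
      using flow_support_tree[OF equiv_R G e0 T z(1,2)] by (auto simp: tree_edges_def)
  qed (use finite_sub_E[OF G] in \<open>auto simp: tree_edges_def\<close>)
  finally show ?thesis by (simp add: sum_distrib_left)
qed

lemma tree_edges_flow:
  assumes G: "G \<subseteq> E" and ne: "tree_edges G \<noteq> {}"
  obtains e0 z where "e0 \<in> G" "qtree (R {}) (G - {e0})" "flow (R {}) G z" "z e0 = 1"
    "\<And>e. e \<in> G \<Longrightarrow> z e \<in> \<int>"
proof -
  obtain e0 where e0: "e0 \<in> G" "qtree (R {}) (G - {e0})" using ne by (auto simp: tree_edges_def)
  from flow_ex[OF equiv_R G this] obtain z where "flow (R {}) G z" "z e0 = 1" "\<And>e. e \<in> G \<Longrightarrow> z e \<in> \<int>"
    by metis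
  then show thesis using that e0 by blast
qed

lemma sum_tree_edges_class:
  assumes G: "G \<subseteq> E" and h: "h respects R {}"
  shows "(\<Sum>e\<in>tree_edges G. volt h e * volt (tree_potential j (G - {e})) e) = 0"
proof (cases "tree_edges G = {}")
  case False
  then obtain e0 z where z: "e0 \<in> G" "qtree (R {}) (G - {e0})" "flow (R {}) G z" "z e0 = 1"
    "\<And>e. e \<in> G \<Longrightarrow> z e \<in> \<int>" using tree_edges_flow[OF G] by metis
  show ?thesis using sum_tree_edges[OF G z] flowD[OF z(3) h] by simp
qed simp

text \<open>The sum is \<open>circ G z i * circ G z j\<close>, where a factor vanishes unless
  \<open>G\<close> is valid relative to its vertex. If no edge can be removed, \<open>G\<close> is
  not valid relative to \<open>i\<close>.\<close>

lemma sum_tree_edges_\<delta>: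
  assumes i: "i \<in> boundary N - roots N" and j: "j \<in> boundary N - roots N" and G: "G \<subseteq> E"
  shows "(\<Sum>e\<in>tree_edges G. volt (\<delta> i) e * volt (tree_potential j (G - {e})) e) =
    (if valid_rel N i G \<and> valid_rel N j G then forest_sgn N G i j else 0)"
proof (cases "tree_edges G = {}")
  case True
  have "\<not> valid_rel N i G"
  proof
    assume "valid_rel N i G"
    then obtain e0 where "e0 \<in> G" "qtree (R {}) (G - {e0})"
      using relative_tree_remove_edge[OF i G] by (auto simp: valid_rel_iff)
    then show False using True by (auto simp: tree_edges_def)
  qed
  then show ?thesis using True by simp
next
  case False
  then obtain e0 z where z: "e0 \<in> G" "qtree (R {}) (G - {e0})" "flow (R {}) G z" "z e0 = 1"
    "\<And>e. e \<in> G \<Longrightarrow> z e \<in> \<int>" using tree_edges_flow[OF G] by metis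
  have "(\<Sum>e\<in>tree_edges G. volt (\<delta> i) e * volt (tree_potential j (G - {e})) e) = circ G z i * circ G z j"
    using sum_tree_edges[OF G z] by (simp add: circ_def mult.commute)
  also have "\<dots> = (if valid_rel N i G \<and> valid_rel N j G then forest_sgn N G i j else 0)"
  proof (cases "valid_rel N i G \<and> valid_rel N j G")
    case True
    then show ?thesis using forest_sgn_eq[OF i j G z] by (simp add: valid_rel_iff)
  next
    case False
    then have "circ G z i = 0 \<or> circ G z j = 0"
      using circ_nonzero_imp_tree[OF i G z(1-4)] circ_nonzero_imp_tree[OF j G z(1-4)] G
      by (auto simp: valid_rel_iff)
    with False show ?thesis by auto
  qed
  finally show ?thesis .
qed

section \<open>Averaging over valid forests\<close>

definition forests :: "nat set set set" where
  "forests = {F. valid N F}"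

lemma forestsD: "F \<in> forests \<Longrightarrow> F \<subseteq> E" "F \<in> forests \<Longrightarrow> qtree (R {}) F"
  by (simp_all add: forests_def valid_iff)

lemma finite_forests: "finite forests"
  by (rule finite_subset[of _ "Pow E"]) (auto simp: finite_E dest: forestsD)

lemma weight_pos: "F \<subseteq> E \<Longrightarrow> 0 < weight N F"
  unfolding weight_def using net_pos by (intro prod_pos) blast

lemma weight_insert: "F \<subseteq> E \<Longrightarrow> e \<notin> F \<Longrightarrow> weight N (insert e F) = c e * weight N F"
  unfolding weight_def using finite_sub_E by simp

definition forest_sum :: real where
  "forest_sum = (\<Sum>F\<in>forests. weight N F)"

lemma forest_sum_pos: "0 < forest_sum"
proof -
  have "forests \<noteq> {}" using spanning_tree_exists by (auto simp: forests_def valid_iff)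
  then show ?thesis
    unfolding forest_sum_def using finite_forests weight_pos forestsD(1) by (intro sum_pos) auto
qed

definition voltage :: "nat \<Rightarrow> nat \<Rightarrow> real" where
  "voltage j x = (\<Sum>F\<in>forests. weight N F * tree_potential j F x) / forest_sum"

text \<open>The pairs of a tree \<open>F\<close> and an edge \<open>e\<close> outside of it are regrouped by \<open>G = F \<union> {e}\<close>.\<close>

lemma power_voltage:
  "(\<Sum>e\<in>E. c e * volt h e * volt (voltage j) e) =
   (\<Sum>G\<in>Pow E. weight N G * (\<Sum>e\<in>tree_edges G. volt h e * volt (tree_potential j (G - {e})) e)) / forest_sum"
proof -
  let ?U = "tree_potential j"
  have "volt (voltage j) e = (\<Sum>F\<in>forests. weight N F * volt (?U F) e) / forest_sum" for e
    unfolding voltage_def[abs_def] volt_div volt_sum volt_scale ..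
  then have "(\<Sum>e\<in>E. c e * volt h e * volt (voltage j) e) =
      (\<Sum>e\<in>E. \<Sum>F\<in>forests. c e * weight N F * volt h e * volt (?U F) e) / forest_sum"
    by (simp add: sum_distrib_left sum_divide_distrib mult.assoc mult.left_commute)
  also have "(\<Sum>e\<in>E. \<Sum>F\<in>forests. c e * weight N F * volt h e * volt (?U F) e) =
      (\<Sum>F\<in>forests. \<Sum>e\<in>E. c e * weight N F * volt h e * volt (?U F) e)"
    by (rule sum.swap)
  \<comment> \<open>Edges of \<open>F\<close> drop out because its potential has no voltage on them;
    elsewhere the conductance is absorbed into the weight.\<close>
  also have "\<dots> = (\<Sum>F\<in>forests. \<Sum>e\<in>E - F. weight N (insert e F) * volt h e * volt (?U F) e)"
  proof (rule sum.cong[OF refl])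
    fix F assume "F \<in> forests"
    note F = forestsD[OF this]
    show "(\<Sum>e\<in>E. c e * weight N F * volt h e * volt (?U F) e) =
        (\<Sum>e\<in>E - F. weight N (insert e F) * volt h e * volt (?U F) e)"
      using tree_potential(2)[OF F] weight_insert[OF F(1)] finite_E
      by (intro sum.mono_neutral_cong_right) auto
  qed
  also have "\<dots> = (\<Sum>(F, e)\<in>(SIGMA F:forests. E - F). weight N (insert e F) * volt h e * volt (?U F) e)"
    using finite_forests finite_E by (intro sum.Sigma) auto
  also have "\<dots> = (\<Sum>(G, e)\<in>(SIGMA G:Pow E. tree_edges G). weight N G * (volt h e * volt (?U (G - {e})) e))"
    by (rule sum.reindex_bij_witness[where i = "\<lambda>(G, e). (G - {e}, e)" and j = "\<lambda>(F, e). (insert e F, e)"])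
      (auto simp: forests_def valid_iff tree_edges_def insert_absorb)
  also have "\<dots> = (\<Sum>G\<in>Pow E. weight N G * (\<Sum>e\<in>tree_edges G. volt h e * volt (?U (G - {e})) e))"
    unfolding sum_distrib_left using finite_E finite_sub_E
    by (intro sum.Sigma[symmetric]) (auto simp: tree_edges_def)
  finally show ?thesis .
qed

text \<open>The normalised weights add up to one, so averaging keeps the difference from
  \<open>\<delta> j\<close> class-constant.\<close>

lemma voltage_respects: "(\<lambda>x. \<delta> j x - voltage j x) respects R {}"
proof -
  have "(\<Sum>F\<in>forests. weight N F * \<delta> j x) = forest_sum * \<delta> j x" for x
    by (simp add: forest_sum_def sum_distrib_right)
  then have "\<delta> j x - voltage j x = (\<Sum>F\<in>forests. weight N F * (\<delta> j x - tree_potential j F x)) / forest_sum" for x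
    using forest_sum_pos by (simp add: voltage_def right_diff_distrib sum_subtractf diff_divide_distrib)
  moreover have "(\<lambda>x. (\<Sum>F\<in>forests. weight N F * (\<delta> j x - tree_potential j F x)) / forest_sum) respects R {}"
    by (intro congruent_div congruent_sum congruent_scale tree_potential forestsD)
  ultimately show ?thesis by presburger
qed

lemma net_current_eq_sum: "k \<in> V \<Longrightarrow> net_current N I k = (\<Sum>v\<in>V. \<delta> k v * net_current N I v)"
  unfolding \<delta>_def by (simp add: of_bool_def if_distrib[of "\<lambda>x. x * _"] finite_V cong: if_cong)

text \<open>The power identity gives conservation against class-constant functions. Indicators of
  interior vertices and of superports turn it into the current conditions, and the voltage
  conditions hold because the jumps are those of \<open>\<delta> j\<close>.\<close>

lemma voltage_solution:
  assumes j: "j \<in> boundary N - roots N"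
  shows "solution N (\<lambda>k. if k = j then 1 else 0) (voltage j)
    (\<lambda>k l. cond N k l * (voltage j k - voltage j l))" (is "solution N ?D ?U ?I")
proof -
  have conserved: "(\<Sum>k\<in>V. h k * net_current N ?I k) = 0" if h: "h respects R {}" for h
  proof -
    have "(\<Sum>k\<in>V. h k * net_current N ?I k) = (\<Sum>e\<in>E. c e * volt h e * volt ?U e)"
      by (rule sum_net_current) simp
    also have "\<dots> = 0" unfolding power_voltage using sum_tree_edges_class[OF _ h] by simp
    finally show ?thesis .
  qed
  show ?thesis unfolding solution_def
  proof (intro conjI ballI)
    fix k assume "k \<in> V - boundary N"
    then show "net_current N ?I k = 0"
      using conserved[OF \<delta>_interior_respects] net_current_eq_sum[of k ?I] by simp
  next
    fix q assume "q \<in> {1..<nports N}"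
    then have q: "q \<in> {1..nports N}" by simp
    have "(\<lambda>v. of_bool (v \<in> port N q) :: real) respects R {}"
    proof (rule congruentI)
      fix u v assume "(u, v) \<in> R {}"
      then have "u \<in> port N q \<longleftrightarrow> v \<in> port N q"
        using port_eqI q by (auto simp: port_equiv_off_def same_port_def) blast+
      then show "of_bool (u \<in> port N q) = (of_bool (v \<in> port N q) :: real)" by simp
    qed
    from conserved[OF this] have "(\<Sum>k\<in>V. of_bool (k \<in> port N q) * net_current N ?I k) = 0" .
    moreover have "(\<Sum>k\<in>V. of_bool (k \<in> port N q) * net_current N ?I k) = (\<Sum>k\<in>port N q. net_current N ?I k)"
      using net_port q finite_V by (intro sum.mono_neutral_cong_right) auto
    ultimately show "(\<Sum>k\<in>port N q. net_current N ?I k) = 0" by simp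
  next
    fix k assume k: "k \<in> boundary N - roots N"
    have "jump (\<lambda>x. \<delta> j x - ?U x) k = 0" using k by (intro jump_eq_0[OF k _ _ voltage_respects]) auto
    then show "?U k - ?U (port_root N k) = (if k = j then 1 else 0)"
      using jump_\<delta>[OF k j] unfolding jump_diff by (auto simp: jump_def)
  qed simp
qed

text \<open>Uniqueness identifies the matrix entry with the current at \<open>i\<close> for the
  averaged voltages, and the test function \<open>\<delta> i\<close> extracts this current from the
  power identity.\<close>

lemma response_matrix_eq:
  assumes i: "i \<in> boundary N - roots N" and j: "j \<in> boundary N - roots N"
  shows "response_matrix N i j =
    (\<Sum>G | valid_rel N i G \<and> valid_rel N j G. forest_sgn N G i j * weight N G) / (\<Sum>F | valid N F. weight N F)"
proof -
  let ?I = "\<lambda>k l. cond N k l * (voltage j k - voltage j l)"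
  have iV: "i \<in> V" using i boundary_sub by blast
  have "response_matrix N i j = net_current N ?I i"
    unfolding response_matrix_def response_map_def
  proof (rule the_equality)
    show "\<exists>U I. solution N (\<lambda>k. if k = j then 1 else 0) U I \<and> net_current N ?I i = net_current N I i"
      using voltage_solution[OF j] by blast
  qed (use solution_unique[OF _ voltage_solution[OF j] iV] in blast)
  also have "\<dots> = (\<Sum>e\<in>E. c e * volt (\<delta> i) e * volt (voltage j) e)"
    unfolding net_current_eq_sum[OF iV, of ?I] by (rule sum_net_current) simp
  also have "\<dots> = (\<Sum>G\<in>Pow E. weight N G *
      (if valid_rel N i G \<and> valid_rel N j G then forest_sgn N G i j else 0)) / forest_sum"
    unfolding power_voltage using sum_tree_edges_\<delta>[OF i j] by simp
  also have "(\<Sum>G\<in>Pow E. weight N G * (if valid_rel N i G \<and> valid_rel N j G then forest_sgn N G i j else 0)) =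
      (\<Sum>G | valid_rel N i G \<and> valid_rel N j G. forest_sgn N G i j * weight N G)"
    using finite_E by (intro sum.mono_neutral_cong_right) (auto simp: valid_rel_iff)
  finally show ?thesis by (simp add: forest_sum_def forests_def)
qed

end

theorem theorem6p2:
  fixes N :: network and i j :: nat
  assumes "superport_network N"
    and "card (boundary N) > nports N"
    and "i \<in> boundary N - roots N"
    and "j \<in> boundary N - roots N"
  shows "response_matrix N i j =
    (\<Sum>G | valid_rel N i G \<and> valid_rel N j G. forest_sgn N G i j * weight N G) /
    (\<Sum>F | valid N F. weight N F)"
proof -
  interpret superport_net N using assms(1) by unfold_locales
  show ?thesis using response_matrix_eq[OF assms(3,4)] .
qed

end
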